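(* Let $Z,Z_1,Z_2,\ldots$ be iid random elements with values in a measurable space $(\mathcal Z,\mathcal A)$ and write $\boldsymbol Z^{(l)}:=(Z_1,\ldots,Z_l)$ for $l\in\mathbb N$. Let $(\Theta,d)$ be a metric space and $\Theta^\circ\subseteq\Theta$ a nonempty subset. Let $m:\Theta^\circ\times\mathcal Z\to\mathbb R\cup\{-\infty\}$, $m_\theta(z):=m(\theta,z)$, be such that $z\mapsto m_\theta(z)$ is measurable for every $\theta\in\Theta^\circ$, and let $M_n(\theta):=n^{-1}\sum_{i=1}^n m_\theta(Z_i)$ for $\theta\in\Theta^\circ$. Fix $k\in\mathbb N$ and, for every $l\in\{k,\ldots,2k-1\}$, let $\overline m^{(l)}:\Theta\times\mathcal Z^l\to\mathbb R\cup\{-\infty\}$ be such that $\boldsymbol z^{(l)}\mapsto\overline m^{(l)}(\theta\mid\boldsymbol z^{(l)})$ is measurable for every $\theta\in\Theta$ and such that (i) for every $\theta\in\Theta^\circ$ and every $\boldsymbol z^{(l)}=(z_1,\ldots,z_l)\in\mathcal Z^l$, $\ \overline m^{(l)}(\theta\mid\boldsymbol z^{(l)})=\frac1l\sum_{i=1}^l m_\theta(z_i)$; (ii) the random map $\theta\mapsto\overline m^{(l)}(\theta\mid\boldsymbol Z^{(l)})$ on $\Theta$ is almost surely upper-semicontinuous and satisfies Wald's integrability condition, both with $\mathcal W=\mathcal Z^l$ and $W=\boldsymbol Z^{(l)}$; (iii) $\mathsf E[\overline m^{(k)}(\theta\mid\boldsymbol Z^{(k)})]=-\infty$ for every $\theta\in\Theta\setminus\Theta^\circ$.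 Let $$\Theta_0:=\Big\{\theta_0\in\Theta^\circ:\ \mathsf E[m_{\theta_0}(Z)]=\sup_{\theta\in\Theta^\circ}\mathsf E[m_\theta(Z)]\Big\}$$ and assume that $\Theta_0$ is nonempty. Then for any $\Theta^\circ$-valued estimator sequence $\hat\theta_n$ such that $M_n(\hat\theta_n)\ge M_n(\theta_0)-o_{\mathsf P}(1)$ for some $\theta_0\in\Theta_0$, we have, for every $\varepsilon>0$ and every compact set $K\subseteq\Theta$, $$\mathsf P\big[d(\hat\theta_n,\Theta_0)\ge\varepsilon\ \text{ and }\ \hat\theta_n\in K\big]\to0\qquad\text{as }n\to\infty,$$ where $d(\hat\theta_n,\Theta_0):=\inf_{\theta\in\Theta_0}d(\hat\theta_n,\theta)$.
   Context: For $\theta\in\Theta$ and $\rho>0$, $B(\theta,\rho)=\{\theta'\in\Theta:d(\theta',\theta)<\rho\}$. Notation: $x_+=\max(x,0)$, $x_-=\max(-x,0)$. A random variable $H$ is quasi-integrable if at least one of $\mathsf E[H_+],\mathsf E[H_-]$ is finite, and then $\mathsf E[H]:=\mathsf E[H_+]-\mathsf E[H_-]\in[-\infty,\infty]$. (Under assumptions (i) and (ii), $\mathsf E[(m_\theta(Z))_+]<\infty$ for $\theta\in\Theta^\circ$, so the expectations defining $\Theta_0$ are well defined in $[-\infty,\infty)$.) Definitions. Let $W$ be a random element in a measurable space $\mathcal W$ with distribution $P_W$ and let $\varphi:\Theta\times\mathcal W\to\mathbb R\cup\{-\infty\}$, $\varphi_\theta(w):=\varphi(\theta,w)$, be such that $w\mapsto\varphi_\theta(w)$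 is measurable for every $\theta\in\Theta$. Almost sure upper-semicontinuity: the random map $\theta\mapsto\varphi_\theta(W)$ is almost surely upper-semicontinuous at $\theta\in\Theta$ if there is a set $\mathcal N_\theta\subseteq\mathcal W$ with $P_W[\mathcal N_\theta]=0$ such that $\limsup_{j\to\infty}\varphi_{\theta_j}(w)\le\varphi_\theta(w)$ for every $w\in\mathcal W\setminus\mathcal N_\theta$ and every sequence $\theta_j\to\theta$ in $\Theta$. It is almost surely upper-semicontinuous if it is so at every $\theta\in\Theta$. Wald's integrability condition: the random map satisfies it at $\theta\in\Theta$ if there exists $\delta>0$ such that (a) $\sup_{\theta'\in B(\theta,\rho)}\varphi_{\theta'}(W)$ is a $[-\infty,\infty]$-valued random variable (i.e., measurable) for every $\rho\in(0,\delta]$, and (b) $\mathsf E\big[\big(\sup_{\theta'\in B(\theta,\delta)}\varphi_{\theta'}(W)\big)_+\big]<\infty$. It satisfies Wald's integrability condition if it does so at every $\theta\in\Theta$. The near-maximizer hypothesis $M_n(\hat\theta_n)\ge M_n(\theta_0)-o_{\mathsf P}(1)$ means that there are $[0,\infty]$-valued random variables $\varrho_n$ converging to $0$ in probability with $M_n(\hat\theta_n)\ge M_n(\theta_0)-\varrho_n$.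
   Formalization: In Wald's condition (a), the supremum must be measurable as a function on the value space of W, up to null sets of the distribution of W; mere measurability of its composition with W on an arbitrary underlying probability space would make the claim false. *)

theory Defs
  imports "HOL-Probability.Probability"
begin

text \<open>
  The metric space \<open>\<Theta>\<close> is the universe of a type of class \<open>metric_space\<close>. Functions with values in
  \<open>\<real> \<union> {-\<infinity>}\<close> are \<open>ereal\<close>-valued functions that avoid \<open>\<infinity>\<close>.
\<close>

text \<open>
  \<open>E[H] = E[H\<^sub>+] - E[H\<^sub>-]\<close>. If both parts are infinite, i.e. \<open>H\<close> is not quasi-integrable, the value is
  \<open>\<infinity> - \<infinity> = \<infinity>\<close> in \<open>ereal\<close>; in particular \<open>expect M H = -\<infinity>\<close> does entail quasi-integrability.
\<close>

definition expect :: "'w measure \<Rightarrow> ('w \<Rightarrow> ereal) \<Rightarrow> ereal" where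
  "expect M H =
     enn2ereal (\<integral>\<^sup>+ \<omega>. e2ennreal (max (H \<omega>) 0) \<partial>M) - enn2ereal (\<integral>\<^sup>+ \<omega>. e2ennreal (max (- H \<omega>) 0) \<partial>M)"

text \<open>In the next definitions, \<open>P\<close> is the distribution of the random element \<open>W\<close> of \<open>space P\<close>.\<close>

definition as_usc_at :: "'x measure \<Rightarrow> ('t::metric_space \<Rightarrow> 'x \<Rightarrow> ereal) \<Rightarrow> 't \<Rightarrow> bool" where
  "as_usc_at P \<phi> \<theta> \<longleftrightarrow>
     (\<exists>N \<in> null_sets P. \<forall>w \<in> space P - N. \<forall>\<theta>s :: nat \<Rightarrow> 't.
        \<theta>s \<longlonglongrightarrow> \<theta> \<longrightarrow> limsup (\<lambda>j. \<phi> (\<theta>s j) w) \<le> \<phi> \<theta> w)"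

definition as_usc :: "'x measure \<Rightarrow> ('t::metric_space \<Rightarrow> 'x \<Rightarrow> ereal) \<Rightarrow> bool" where
  "as_usc P \<phi> \<longleftrightarrow> (\<forall>\<theta>. as_usc_at P \<phi> \<theta>)"

text \<open>
  Measurability of the suprema is understood on the range space of \<open>W\<close>, up to \<open>P\<close>-null sets, so
  that it is a property of the distribution of \<open>W\<close>. Measurability of the composition with \<open>W\<close> on
  the underlying probability space would be too weak: it says nothing about the composition with an
  independent copy of \<open>W\<close> if the underlying sigma-algebra is larger than the one generated by the
  observations.
\<close>

definition wald_integrable_at :: "'x measure \<Rightarrow> ('t::metric_space \<Rightarrow> 'x \<Rightarrow> ereal) \<Rightarrow> 't \<Rightarrow> bool" where
  "wald_integrable_at P \<phi> \<theta> \<longleftrightarrow>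
     (\<exists>\<delta>>0.
        (\<forall>\<rho>. 0 < \<rho> \<and> \<rho> \<le> \<delta> \<longrightarrow> (\<lambda>w. SUP \<theta>'\<in>ball \<theta> \<rho>. \<phi> \<theta>' w) \<in> borel_measurable (completion P)) \<and>
        (\<integral>\<^sup>+ w. e2ennreal (max (SUP \<theta>'\<in>ball \<theta> \<delta>. \<phi> \<theta>' w) 0) \<partial>completion P) < \<infinity>)"

definition wald_integrable :: "'x measure \<Rightarrow> ('t::metric_space \<Rightarrow> 'x \<Rightarrow> ereal) \<Rightarrow> bool" where
  "wald_integrable P \<phi> \<longleftrightarrow> (\<forall>\<theta>. wald_integrable_at P \<phi> \<theta>)"

text \<open>
  The family \<open>Z 0, Z 1, Z 2, \<dots>\<close> stands for \<open>Z, Z\<^sub>1, Z\<^sub>2, \<dots>\<close>: the generic element \<open>Z\<close> is \<open>Z 0\<close>, and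
  the sample starts at index 1.
\<close>

definition iid :: "'w measure \<Rightarrow> 'z measure \<Rightarrow> (nat \<Rightarrow> 'w \<Rightarrow> 'z) \<Rightarrow> bool" where
  "iid M A Z \<longleftrightarrow>
     prob_space.indep_vars M (\<lambda>_. A) Z UNIV \<and> (\<forall>i. distr M A (Z i) = distr M A (Z 0))"

abbreviation power_space :: "'z measure \<Rightarrow> nat \<Rightarrow> (nat \<Rightarrow> 'z) measure" where
  "power_space A l \<equiv> Pi\<^sub>M {1..l} (\<lambda>_. A)"

definition sample :: "(nat \<Rightarrow> 'w \<Rightarrow> 'z) \<Rightarrow> nat \<Rightarrow> 'w \<Rightarrow> nat \<Rightarrow> 'z" where
  "sample Z l \<omega> = (\<lambda>i\<in>{1..l}. Z i \<omega>)"

definition mean :: "('t \<Rightarrow> 'z \<Rightarrow> ereal) \<Rightarrow> nat \<Rightarrow> 't \<Rightarrow> (nat \<Rightarrow> 'z) \<Rightarrow> ereal" where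
  "mean m l \<theta> z = (\<Sum>i=1..l. m \<theta> (z i)) / ereal (real l)"

definition maximizers :: "'w measure \<Rightarrow> 't set \<Rightarrow> ('t \<Rightarrow> 'z \<Rightarrow> ereal) \<Rightarrow> ('w \<Rightarrow> 'z) \<Rightarrow> 't set" where
  "maximizers M T m Z =
     {\<theta>\<^sub>0 \<in> T. expect M (\<lambda>\<omega>. m \<theta>\<^sub>0 (Z \<omega>)) = (SUP \<theta>\<in>T. expect M (\<lambda>\<omega>. m \<theta> (Z \<omega>)))}"

text \<open>
  Sequences of random variables are indexed by \<open>n \<ge> 1\<close>. With \<open>Mn n \<theta> \<omega>\<close> the criterion function, the
  following is \<open>Mn n (\<theta>hat n) \<ge> Mn n \<theta>\<^sub>0 - o\<^sub>P(1)\<close>. Here \<open>-\<infinity> - \<infinity> = -\<infinity>\<close> in \<open>ereal\<close>, so that \<open>\<rho> n \<omega> = \<infinity>\<close>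
  never imposes a condition as long as \<open>Mn n \<theta>\<^sub>0 \<omega> < \<infinity>\<close>. The estimators \<open>\<theta>hat n\<close> are arbitrary maps;
  probabilities of events about them are therefore stated with \<open>outer_measure_of\<close>, which agrees
  with the probability on measurable events.
\<close>

definition near_maximizer ::
  "'w measure \<Rightarrow> (nat \<Rightarrow> 't \<Rightarrow> 'w \<Rightarrow> ereal) \<Rightarrow> (nat \<Rightarrow> 'w \<Rightarrow> 't) \<Rightarrow> 't \<Rightarrow> bool" where
  "near_maximizer M Mn \<theta>hat \<theta>\<^sub>0 \<longleftrightarrow>
     (\<exists>\<rho> :: nat \<Rightarrow> 'w \<Rightarrow> ereal.
        (\<forall>n\<ge>1. \<rho> n \<in> borel_measurable M) \<and>
        (\<forall>n\<ge>1. \<forall>\<omega>\<in>space M. 0 \<le> \<rho> n \<omega> \<and> Mn n (\<theta>hat n \<omega>) \<omega> \<ge> Mn n \<theta>\<^sub>0 \<omega> - \<rho> n \<omega>) \<and>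
        (\<forall>\<eta>>0. (\<lambda>n. measure M {\<omega> \<in> space M. \<rho> n \<omega> > ereal \<eta>}) \<longlonglongrightarrow> 0))"

end

theory Submission
  imports Defs
begin

text \<open>
  Write \<open>n = q k + l\<close> with \<open>k \<le> l < 2 k\<close> and cut the sample into \<open>q\<close> independent blocks of length
  \<open>k\<close> and a last block of length \<open>l\<close>, so that \<open>M\<^sub>n(\<theta>)\<close> is a weighted mean of block means. If \<open>\<theta>\<close> is
  not a maximizer, upper semicontinuity and dominated convergence bound the block means of length
  \<open>k\<close>, uniformly on a small ball around \<open>\<theta>\<close>, by a function of the block whose expectation is below
  the maximum \<open>v\<close>; the last block is bounded by an integrable function and contributes \<open>o\<^sub>P(1)\<close>. By
  the weak law the criterion on the ball stays below \<open>v\<close> while \<open>M\<^sub>n(\<theta>\<^sub>0)\<close> tends to \<open>v\<close>, hence the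
  estimator leaves the ball. Finitely many such balls cover the relevant part of \<open>K\<close>.
\<close>

text \<open>The assumptions speak of block means, and this shapes the proof. A mean of fewer than
  \<open>k\<close> observations need not have an integrable upper bound near a parameter, so the
  \<open>n mod k\<close> left-over observations are joined to a full block; hence the lengths from
  \<open>k\<close> to \<open>2 k - 1\<close>. At a point outside \<open>T\<close> there is no
  \<open>m\<close> to compare with, but the expectation -\<infinity> of its block mean yields a
  bound below \<open>v\<close> just as for a non-maximizer in \<open>T\<close>. Even the
  integrability of the positive part of \<open>m\<close> at a maximizer has to be extracted from
  block means, by independence. If the maximal value is -\<infinity>, every point of
  \<open>T\<close> is a maximizer and nothing is left to show; otherwise there is a strict gap below
  a finite \<open>v\<close> that can be divided among the error terms. As the estimators are
  arbitrary maps, every event about them is covered by a measurable one of small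
  probability.\<close>

subsection \<open>Weak law of large numbers\<close>

text \<open>
  The summands are truncated at a fixed level \<open>c\<close>; Hoeffding's inequality controls the bounded part
  and Markov's inequality the remainder.
\<close>

lemma (in prob_space) weak_law_of_large_numbers:
  fixes X :: "nat \<Rightarrow> 'a \<Rightarrow> real"
  assumes indep: "indep_vars (\<lambda>_. borel) X UNIV"
    and distr_eq: "\<And>i. distr M borel (X i) = distr M borel (X 0)"
    and int: "integrable M (X 0)" and "\<eta> > 0"
  shows "(\<lambda>n. prob {\<omega> \<in> space M. \<bar>(\<Sum>i<n. X i \<omega>) / real n - expectation (X 0)\<bar> \<ge> \<eta>}) \<longlonglongrightarrow> 0"
proof (rule LIMSEQ_I)
  fix \<delta> :: real assume "\<delta> > 0"
  have X_meas[measurable]: "X i \<in> borel_measurable M" for i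
    using indep unfolding indep_vars_def by auto
  have transfer: "integrable M (\<lambda>\<omega>. h (X i \<omega>)) \<longleftrightarrow> integrable M (\<lambda>\<omega>. h (X 0 \<omega>))"
    "expectation (\<lambda>\<omega>. h (X i \<omega>)) = expectation (\<lambda>\<omega>. h (X 0 \<omega>))"
    if [measurable]: "h \<in> borel_measurable borel" for h :: "real \<Rightarrow> real" and i
    using integrable_distr_eq[of "X i" M borel h] integrable_distr_eq[of "X 0" M borel h]
      integral_distr[of "X i" M borel h] integral_distr[of "X 0" M borel h] distr_eq[of i]
    by auto
  define f :: "real \<Rightarrow> real \<Rightarrow> real" where "f c x = (if \<bar>x\<bar> \<le> c then x else 0)" for c x
  have f_meas[measurable]: "f c \<in> borel_measurable borel" for c
    unfolding f_def by measurable
  have f_bound: "\<bar>f c x\<bar> \<le> \<bar>x\<bar>" for c x by (simp add: f_def)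
  define t where "t c = expectation (\<lambda>\<omega>. \<bar>X 0 \<omega> - f c (X 0 \<omega>)\<bar>)" for c
  have "(\<lambda>j. t (real j)) \<longlonglongrightarrow> expectation (\<lambda>\<omega>. 0)"
    unfolding t_def
  proof (rule integral_dominated_convergence[where w = "\<lambda>\<omega>. 2 * \<bar>X 0 \<omega>\<bar>"])
    show "integrable M (\<lambda>\<omega>. 2 * \<bar>X 0 \<omega>\<bar>)" using int by auto
    show "AE \<omega> in M. (\<lambda>j. \<bar>X 0 \<omega> - f (real j) (X 0 \<omega>)\<bar>) \<longlonglongrightarrow> 0"
    proof (rule AE_I2)
      fix \<omega>
      obtain j0 :: nat where "\<bar>X 0 \<omega>\<bar> \<le> real j0" using real_arch_simple by blast
      then have "eventually (\<lambda>j. \<bar>X 0 \<omega> - f (real j) (X 0 \<omega>)\<bar> = 0) sequentially"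
        by (intro eventually_sequentiallyI[of j0]) (auto simp: f_def)
      then show "(\<lambda>j. \<bar>X 0 \<omega> - f (real j) (X 0 \<omega>)\<bar>) \<longlonglongrightarrow> 0"
        by (rule tendsto_eventually)
    qed
    show "AE \<omega> in M. norm \<bar>X 0 \<omega> - f (real j) (X 0 \<omega>)\<bar> \<le> 2 * \<bar>X 0 \<omega>\<bar>" for j
      by (auto simp: f_def)
  qed auto
  then have "(\<lambda>j. t (real j)) \<longlonglongrightarrow> 0" by simp
  \<comment> \<open>The first bound puts the truncated mean within \<open>\<eta>/3\<close> of the
    true mean. The second makes Markov's inequality at level \<open>n \<eta>/3\<close> give at most
    \<open>\<delta>/2\<close> for the sum of the remainders.\<close>
  then have "eventually (\<lambda>j. t (real j) < min (\<eta>/3) (\<delta> * \<eta> / 6)) sequentially"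
    using \<open>\<delta> > 0\<close> \<open>\<eta> > 0\<close> by (intro order_tendstoD) auto
  moreover have "eventually (\<lambda>j::nat. j \<ge> 1) sequentially"
    by (rule eventually_ge_at_top)
  ultimately have "\<exists>j. t (real j) < min (\<eta>/3) (\<delta> * \<eta> / 6) \<and> j \<ge> 1"
    by (intro eventually_happens'[OF sequentially_bot] eventually_conj)
  then obtain j where j: "t (real j) < min (\<eta>/3) (\<delta> * \<eta> / 6)" "j \<ge> 1"
    by blast
  define c where "c = real j"
  have c: "t c < \<eta>/3" "t c < \<delta> * \<eta> / 6" "c > 0"
    using j by (auto simp: c_def)
  have int_f: "integrable M (\<lambda>\<omega>. f c (X 0 \<omega>))"
    by (rule Bochner_Integration.integrable_bound[OF int]) (auto simp: f_bound)
  let ?A = "\<lambda>n. {\<omega> \<in> space M. \<bar>(\<Sum>i<n. X i \<omega>) / real n - expectation (X 0)\<bar> \<ge> \<eta>}"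
  let ?B = "\<lambda>n. {\<omega> \<in> space M. \<bar>(\<Sum>i<n. f c (X i \<omega>)) / real n - expectation (\<lambda>\<omega>. f c (X 0 \<omega>))\<bar> \<ge> \<eta>/3}"
  let ?C = "\<lambda>n. {\<omega> \<in> space M. (\<Sum>i<n. \<bar>X i \<omega> - f c (X i \<omega>)\<bar>) \<ge> real n * \<eta>/3}"
  have mean_diff: "\<bar>expectation (X 0) - expectation (\<lambda>\<omega>. f c (X 0 \<omega>))\<bar> < \<eta>/3"
  proof -
    have "expectation (X 0) - expectation (\<lambda>\<omega>. f c (X 0 \<omega>)) = expectation (\<lambda>\<omega>. X 0 \<omega> - f c (X 0 \<omega>))"
      using int int_f by simp
    also have "\<bar>\<dots>\<bar> \<le> t c"
      unfolding t_def by (rule integral_abs_bound)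
    finally show ?thesis using c by simp
  qed
  \<comment> \<open>The truncation bias of the mean uses up less than \<open>\<eta>/3\<close>, so
    the truncated average or the average remainder must account for at least
    \<open>\<eta>/3\<close>.\<close>
  have sub: "?A n \<subseteq> ?B n \<union> ?C n" if "n \<ge> 1" for n
  proof
    fix \<omega> assume w: "\<omega> \<in> ?A n"
    have "(\<Sum>i<n. X i \<omega>) / real n - (\<Sum>i<n. f c (X i \<omega>)) / real n = (\<Sum>i<n. X i \<omega> - f c (X i \<omega>)) / real n"
      by (simp add: sum_subtractf diff_divide_distrib)
    also have "\<bar>\<dots>\<bar> \<le> (\<Sum>i<n. \<bar>X i \<omega> - f c (X i \<omega>)\<bar>) / real n"
      by (simp add: divide_right_mono sum_abs)
    finally have *: "\<bar>(\<Sum>i<n. X i \<omega>) / real n - (\<Sum>i<n. f c (X i \<omega>)) / real n\<bar> \<le> \<dots>" .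
    show "\<omega> \<in> ?B n \<union> ?C n"
    proof (cases "\<omega> \<in> ?C n")
      case False
      then have "(\<Sum>i<n. \<bar>X i \<omega> - f c (X i \<omega>)\<bar>) / real n < \<eta>/3"
        using w that by (simp add: field_simps)
      moreover have "\<eta> \<le> \<bar>(\<Sum>i<n. X i \<omega>) / real n - expectation (X 0)\<bar>" using w by simp
      ultimately have "\<eta>/3 \<le> \<bar>(\<Sum>i<n. f c (X i \<omega>)) / real n - expectation (\<lambda>\<omega>. f c (X 0 \<omega>))\<bar>"
        using * mean_diff by linarith
      then show ?thesis using w by simp
    qed auto
  qed
  \<comment> \<open>The exponent is that of Hoeffding for summands in an interval of length
    \<open>2 c\<close> and deviation \<open>\<eta>/3\<close>: twice \<open>(\<eta>/3)\<close>
    squared over \<open>(2 c)\<close> squared.\<close>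
  have B: "prob (?B n) \<le> 2 * exp (- (\<eta>\<^sup>2/(18*c\<^sup>2)) * real n)" if "n \<ge> 1" for n
  proof -
    interpret H: Hoeffding_ineq_iid M "{..<n}" "\<lambda>i \<omega>. f c (X i \<omega>)" "\<lambda>\<omega>. f c (X 0 \<omega>)" "-c" c
      "expectation (\<lambda>\<omega>. f c (X 0 \<omega>))"
    proof unfold_locales
      show "indep_vars (\<lambda>_. borel) (\<lambda>i \<omega>. f c (X i \<omega>)) {..<n}"
        by (rule indep_vars_compose2[OF indep_vars_subset[OF indep]]) auto
      show "distr M borel (\<lambda>\<omega>. f c (X i \<omega>)) = distr M borel (\<lambda>\<omega>. f c (X 0 \<omega>))" for i
        using distr_distr[of "f c" borel borel "X i" M] distr_distr[of "f c" borel borel "X 0" M] distr_eq[of i]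
        by (simp add: comp_def)
      show "AE \<omega> in M. f c (X 0 \<omega>) \<in> {- c..c}"
        using c by (auto simp: f_def abs_le_iff)
    qed auto
    have "prob (?B n) \<le> 2 * exp (-2 * real (card {..<n}) * (\<eta>/3)\<^sup>2 / (c - - c)\<^sup>2)"
      using H.Hoeffding_ineq_abs_ge'[of "\<eta>/3", unfolded card_lessThan] \<open>\<eta> > 0\<close> c(3) that
      unfolding card_lessThan by (simp only: lessThan_empty_iff)
    also have "-2 * real (card {..<n}) * (\<eta>/3)\<^sup>2 / (c - - c)\<^sup>2 = - (\<eta>\<^sup>2/(18*c\<^sup>2)) * real n"
      using c by (simp add: field_simps power2_eq_square)
    finally show ?thesis .
  qed
  have C: "prob (?C n) \<le> \<delta> / 2" if "n \<ge> 1" for n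
  proof -
    have int_d: "integrable M (\<lambda>\<omega>. \<bar>X i \<omega> - f c (X i \<omega>)\<bar>)" for i
      using transfer(1)[of "\<lambda>x. \<bar>x - f c x\<bar>" i] int int_f by auto
    have "prob (?C n) \<le> expectation (\<lambda>\<omega>. \<Sum>i<n. \<bar>X i \<omega> - f c (X i \<omega>)\<bar>) / (real n * \<eta>/3)"
      using int_d that \<open>\<eta> > 0\<close>
      by (intro integral_Markov_inequality_measure[where A = "{}"]) (auto simp: sum_nonneg)
    also have "expectation (\<lambda>\<omega>. \<Sum>i<n. \<bar>X i \<omega> - f c (X i \<omega>)\<bar>) = (\<Sum>i<n. t c)"
      unfolding t_def Bochner_Integration.integral_sum[OF int_d]
      by (intro sum.cong refl transfer(2)) measurable
    also have "(\<Sum>i<n. t c) / (real n * \<eta>/3) = t c * 3 / \<eta>"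
      using that by simp
    also have "\<dots> \<le> \<delta> / 2" using c \<open>\<eta> > 0\<close> by (simp add: field_simps)
    finally show ?thesis .
  qed
  have "(\<lambda>n. 2 * exp (- (\<eta>\<^sup>2/(18*c\<^sup>2)) * real n)) \<longlonglongrightarrow> 2 * 0"
  proof (intro tendsto_mult tendsto_const filterlim_compose[OF exp_at_bot])
    have "\<eta>\<^sup>2/(18*c\<^sup>2) > 0" using \<open>\<eta> > 0\<close> c by simp
    then show "filterlim (\<lambda>n. - (\<eta>\<^sup>2/(18*c\<^sup>2)) * real n) at_bot sequentially"
      by (intro filterlim_tendsto_neg_mult_at_bot[OF tendsto_const _ filterlim_real_sequentially]) simp
  qed
  then have "eventually (\<lambda>n. 2 * exp (- (\<eta>\<^sup>2/(18*c\<^sup>2)) * real n) < \<delta>/2) sequentially"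
    using \<open>\<delta> > 0\<close> unfolding mult_zero_right by (elim order_tendstoD(2)) simp
  then have "eventually (\<lambda>n. prob (?A n) < \<delta>) sequentially"
    using eventually_ge_at_top[of 1]
  proof eventually_elim
    case (elim n)
    have "prob (?A n) \<le> prob (?B n \<union> ?C n)"
      using sub elim by (intro finite_measure_mono) auto
    also have "\<dots> \<le> prob (?B n) + prob (?C n)"
      by (intro measure_Un_le) auto
    also have "\<dots> < \<delta>" using B[of n] C[of n] elim by linarith
    finally show ?case .
  qed
  then show "\<exists>no. \<forall>n\<ge>no. norm (prob (?A n) - 0) < \<delta>"
    by (auto simp: eventually_sequentially)
qed

subsection \<open>Integrable upper bounds\<close>

lemma e2ennreal_max_0: "e2ennreal (max x 0) = e2ennreal x"
  by (simp add: max_def e2ennreal_neg)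

lemma expect_distr:
  assumes [measurable]: "X \<in> measurable M N" "f \<in> borel_measurable N"
  shows "expect (distr M N X) f = expect M (\<lambda>\<omega>. f (X \<omega>))"
  unfolding expect_def by (simp add: nn_integral_distr)

lemma expect_eq_integral:
  assumes [measurable]: "f \<in> borel_measurable M"
    and pos: "(\<integral>\<^sup>+ x. e2ennreal (f x) \<partial>M) < \<infinity>" and neg: "(\<integral>\<^sup>+ x. e2ennreal (- f x) \<partial>M) < \<infinity>"
  shows "integrable M (\<lambda>x. real_of_ereal (f x))"
    and "AE x in M. \<bar>f x\<bar> \<noteq> \<infinity>"
    and "expect M f = ereal (\<integral>x. real_of_ereal (f x) \<partial>M)"
proof -
  have "AE x in M. e2ennreal (f x) \<noteq> \<infinity>"
    by (rule nn_integral_PInf_AE) (use pos in auto)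
  moreover have "AE x in M. e2ennreal (- f x) \<noteq> \<infinity>"
    by (rule nn_integral_PInf_AE) (use neg in auto)
  ultimately show fin: "AE x in M. \<bar>f x\<bar> \<noteq> \<infinity>"
  proof eventually_elim
    case (elim x)
    then show ?case by (cases "f x") auto
  qed
  have eq: "(\<integral>\<^sup>+ x. ennreal (real_of_ereal (f x)) \<partial>M) = (\<integral>\<^sup>+ x. e2ennreal (f x) \<partial>M)"
    "(\<integral>\<^sup>+ x. ennreal (- real_of_ereal (f x)) \<partial>M) = (\<integral>\<^sup>+ x. e2ennreal (- f x) \<partial>M)"
    using fin by (auto intro!: nn_integral_cong_AE elim!: eventually_mono)
  show int: "integrable M (\<lambda>x. real_of_ereal (f x))"
    using pos neg by (subst real_integrable_def) (auto simp: eq)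
  obtain a b where ab: "(\<integral>\<^sup>+ x. e2ennreal (f x) \<partial>M) = ennreal a" "(\<integral>\<^sup>+ x. e2ennreal (- f x) \<partial>M) = ennreal b"
    "a \<ge> 0" "b \<ge> 0"
    using pos neg unfolding infinity_ennreal_def less_top_ennreal by blast
  show "expect M f = ereal (\<integral>x. real_of_ereal (f x) \<partial>M)"
    unfolding expect_def e2ennreal_max_0 real_lebesgue_integral_def[OF int] eq ab(1,2)
    using ab(3,4) by (simp add: enn2ereal_ennreal)
qed

text \<open>Cutting off the negative part at a level \<open>n\<close> gives a function above
  \<open>f\<close> that is integrable, the measure being finite, and whose integral decreases to
  \<open>expect M f\<close> as \<open>n\<close> grows. This replaces \<open>f\<close> by a real
  integrable bound even if \<open>expect M f\<close> is -\<infinity>, as happens off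
  \<open>T\<close>.\<close>

lemma expect_less_imp_integrable_bound:
  assumes [measurable]: "f \<in> borel_measurable M" and less: "expect M f < ereal v"
    and "finite_measure M"
  shows "\<exists>g. integrable M g \<and> (AE x in M. f x \<le> ereal (g x)) \<and> integral\<^sup>L M g < v"
proof -
  interpret finite_measure M by fact
  define fp where "fp x = e2ennreal (max (f x) 0)" for x
  define fn where "fn x = e2ennreal (max (- f x) 0)" for x
  have [measurable]: "fp \<in> borel_measurable M" "fn \<in> borel_measurable M"
    unfolding fp_def fn_def by measurable
  \<comment> \<open>In \<open>ereal\<close> the difference \<infinity> - x is always \<infinity>, so
    a value below \<open>v\<close> forces the positive part to be finite.\<close>
  have fp_fin: "integral\<^sup>N M fp < \<infinity>"
    using less unfolding expect_def fp_def[symmetric] by (cases "integral\<^sup>N M fp") auto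
  have fp_AE: "AE x in M. fp x \<noteq> \<infinity>"
    using fp_fin by (intro nn_integral_PInf_AE) auto
  define a where "a = enn2real (integral\<^sup>N M fp)"
  have a: "integral\<^sup>N M fp = ennreal a" "a \<ge> 0"
    using fp_fin by (auto simp: a_def)
  have int_p: "has_bochner_integral M (\<lambda>x. enn2real (fp x)) a"
  proof (rule has_bochner_integral_nn_integral)
    show "(\<integral>\<^sup>+ x. ennreal (enn2real (fp x)) \<partial>M) = ennreal a"
      unfolding a(1)[symmetric] using fp_AE by (intro nn_integral_cong_AE) (auto simp: less_top)
  qed (use a in auto)
  have "(SUP n. \<integral>\<^sup>+ x. min (fn x) (of_nat n) \<partial>M) = (\<integral>\<^sup>+ x. (SUP n. min (fn x) (of_nat n)) \<partial>M)"
    by (rule nn_integral_monotone_convergence_SUP[symmetric])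
       (auto simp: incseq_def le_fun_def min.coboundedI2)
  also have "\<dots> = integral\<^sup>N M fn"
    by (simp add: inf_min[symmetric] inf_SUP[symmetric] ennreal_SUP_of_nat_eq_top)
  finally have SUP_eq: "(SUP n. \<integral>\<^sup>+ x. min (fn x) (of_nat n) \<partial>M) = integral\<^sup>N M fn" .
  have "ereal (a - v) < enn2ereal (integral\<^sup>N M fn)"
    using less a unfolding expect_def fp_def[symmetric] fn_def[symmetric]
    by (cases "enn2ereal (integral\<^sup>N M fn)") (auto simp: enn2ereal_ennreal)
  then have fn_gt: "ennreal (a - v) < integral\<^sup>N M fn" if "a \<ge> v"
    using that by (simp add: less_ennreal.rep_eq enn2ereal_ennreal)
  \<comment> \<open>For \<open>a < v\<close> the conversion to \<open>ennreal\<close> would turn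
    \<open>a - v\<close> into 0 and lose the strict inequality; in that case every level
    \<open>n\<close> works, because \<open>b \<ge> 0\<close>.\<close>
  have "\<exists>n. a < v \<or> ennreal (a - v) < (\<integral>\<^sup>+ x. min (fn x) (of_nat n) \<partial>M)"
    using fn_gt unfolding SUP_eq[symmetric] less_SUP_iff by (cases "a \<ge> v") auto
  then obtain n where n: "a < v \<or> ennreal (a - v) < (\<integral>\<^sup>+ x. min (fn x) (of_nat n) \<partial>M)"
    by blast
  define b where "b = enn2real (\<integral>\<^sup>+ x. min (fn x) (of_nat n) \<partial>M)"
  have "(\<integral>\<^sup>+ x. min (fn x) (of_nat n) \<partial>M) \<le> (\<integral>\<^sup>+ x. of_nat n \<partial>M)"
    by (intro nn_integral_mono) auto
  also have "\<dots> < \<infinity>"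
    by (simp add: ennreal_mult_less_top emeasure_finite less_top[symmetric] ennreal_mult_eq_top_iff)
  finally have b: "(\<integral>\<^sup>+ x. min (fn x) (of_nat n) \<partial>M) = ennreal b" "b \<ge> 0"
    by (auto simp: b_def)
  have min_fin: "min (fn x) (of_nat n) < \<top>" for x
    by (simp add: min_less_iff_disj of_nat_less_top)
  have int_n: "has_bochner_integral M (\<lambda>x. enn2real (min (fn x) (of_nat n))) b"
    using b min_fin by (intro has_bochner_integral_nn_integral) auto
  have "a - v < b" using n b by (cases "a < v") (auto simp: ennreal_less_iff)
  let ?g = "\<lambda>x. enn2real (fp x) - enn2real (min (fn x) (of_nat n))"
  have "has_bochner_integral M ?g (a - b)"
    by (intro has_bochner_integral_diff int_p int_n)
  moreover have "AE x in M. f x \<le> ereal (?g x)"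
    using fp_AE
  proof eventually_elim
    case (elim x)
    show ?case
    proof (cases "f x")
      case (real r)
      show ?thesis
      proof (cases "r \<ge> 0")
        case True
        then have "fp x = ennreal r" "fn x = 0"
          using real by (auto simp: fp_def fn_def max_def e2ennreal_ereal)
        then show ?thesis using real True by simp
      next
        case False
        then have "fp x = 0" "fn x = ennreal (-r)"
          using real by (auto simp: fp_def fn_def max_def e2ennreal_ereal)
        then show ?thesis using real False
          by (auto simp: min_def ennreal_of_nat_eq_real_of_nat)
      qed
    next
      case PInf
      then show ?thesis using elim by (simp add: fp_def max_def)
    qed simp
  qed
  ultimately show ?thesis
    using \<open>a - v < b\<close> by (intro exI[of _ ?g]) (auto simp: has_bochner_integral_iff)
qed


text \<open>Along shrinking balls the suprema of \<open>\<phi>\<close> have a limit of at most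
  \<open>\<phi> \<theta> \<le> g\<close> almost everywhere, by upper semicontinuity. Their maxima
  with \<open>g\<close> therefore converge to \<open>g\<close>, and dominated convergence brings
  their integrals below \<open>v\<close> for a small enough ball.\<close>

lemma as_usc_wald_integrable_bound:
  fixes \<phi> :: "'t::metric_space \<Rightarrow> 'x \<Rightarrow> ereal"
  assumes usc: "as_usc_at P \<phi> \<theta>" and wald: "wald_integrable_at P \<phi> \<theta>"
    and g: "integrable P g" "AE w in P. \<phi> \<theta> w \<le> ereal (g w)" "integral\<^sup>L P g < v"
  shows "\<exists>\<rho>>0. \<exists>G. integrable P G \<and> integral\<^sup>L P G < v \<and>
           (AE w in P. \<forall>\<theta>'\<in>ball \<theta> \<rho>. \<phi> \<theta>' w \<le> ereal (G w))"
proof -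
  obtain \<delta> where "\<delta> > 0"
    and meas: "\<And>\<rho>. 0 < \<rho> \<Longrightarrow> \<rho> \<le> \<delta> \<Longrightarrow>
      (\<lambda>w. SUP \<theta>'\<in>ball \<theta> \<rho>. \<phi> \<theta>' w) \<in> borel_measurable (completion P)"
    and fin: "(\<integral>\<^sup>+ w. e2ennreal (max (SUP \<theta>'\<in>ball \<theta> \<delta>. \<phi> \<theta>' w) 0) \<partial>completion P) < \<infinity>"
    using wald unfolding wald_integrable_at_def by blast
  \<comment> \<open>The radii start at \<open>r 0 = \<delta>\<close>, so that Wald's condition
    bounds the positive part of the largest supremum \<open>S 0\<close>, which dominates all
    others.\<close>
  define r where "r j = \<delta> / real (Suc j)" for j
  have r: "0 < r j" "r j \<le> \<delta>" for j
    using \<open>\<delta> > 0\<close> by (auto simp: r_def field_simps)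
  define S where "S j w = (SUP \<theta>'\<in>ball \<theta> (r j). \<phi> \<theta>' w)" for j w
  have S_meas[measurable]: "S j \<in> borel_measurable (completion P)" for j
    unfolding S_def using meas r by blast
  have S_antimono: "S j w \<le> S i w" if "i \<le> j" for i j w
    unfolding S_def
    by (intro SUP_subset_mono subset_ball) (use that \<open>\<delta> > 0\<close> in \<open>auto simp: r_def field_simps\<close>)
  have S_upper: "\<phi> \<theta>' w \<le> S j w" if "\<theta>' \<in> ball \<theta> (r j)" for j \<theta>' w
    unfolding S_def using that by (rule SUP_upper)
  define h where "h w = e2ennreal (max (S 0 w) 0)" for w
  have [measurable]: "h \<in> borel_measurable (completion P)"
    unfolding h_def by measurable
  have h_fin: "integral\<^sup>N (completion P) h < \<infinity>"
    using fin by (simp add: h_def[abs_def] S_def r_def)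
  have g_meas[measurable]: "g \<in> borel_measurable P" using g by auto
  then have [measurable]: "g \<in> borel_measurable (completion P)" by (rule measurable_completion)
  have int_g: "integrable (completion P) g" "integral\<^sup>L (completion P) g = integral\<^sup>L P g"
    using g by (auto simp: integrable_completion integral_completion)
  have AE_h: "AE w in completion P. h w \<noteq> \<infinity>"
    using h_fin by (intro nn_integral_PInf_AE) auto
  have int_h: "integrable (completion P) (\<lambda>w. enn2real (h w))"
  proof (rule integrableI_bounded)
    have "(\<integral>\<^sup>+ w. ennreal (norm (enn2real (h w))) \<partial>completion P) = integral\<^sup>N (completion P) h"
      using AE_h by (intro nn_integral_cong_AE) (auto simp: less_top)
    then show "(\<integral>\<^sup>+ w. ennreal (norm (enn2real (h w))) \<partial>completion P) < \<infinity>"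
      using h_fin by simp
  qed auto
  \<comment> \<open>The suprema may equal -\<infinity> or have a non-integrable negative part. The
    maximum with \<open>g\<close> supplies an integrable lower bound and does not change the
    limit.\<close>
  define G where "G j w = real_of_ereal (max (S j w) (ereal (g w)))" for j w
  have [measurable]: "G j \<in> borel_measurable (completion P)" for j
    unfolding G_def by measurable
  have AE_max_fin: "AE w in completion P. \<forall>j. max (S j w) (ereal (g w)) = ereal (G j w)"
    using AE_h
  proof eventually_elim
    case (elim w)
    then have "S 0 w \<noteq> \<infinity>" by (auto simp: h_def)
    then have "S j w \<noteq> \<infinity>" for j using S_antimono[of 0 j w] by auto
    then show ?case unfolding G_def by (auto simp: max_def ereal_real)
  qed
  have dom: "AE w in completion P. norm (G j w) \<le> \<bar>g w\<bar> + enn2real (h w)" for j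
    using AE_max_fin AE_h
  proof eventually_elim
    case (elim w)
    have "ereal (G j w) = max (S j w) (ereal (g w))" using elim by simp
    also have "\<dots> \<le> max (S 0 w) (ereal (g w))"
      using S_antimono[of 0 j w] by (auto simp: max.coboundedI1)
    also have "\<dots> \<le> ereal (\<bar>g w\<bar> + enn2real (h w))"
    proof (cases "S 0 w")
      case (real s)
      then show ?thesis by (cases "s \<ge> 0") (auto simp: h_def max_def)
    qed (use elim in \<open>auto simp: h_def\<close>)
    finally have "G j w \<le> \<bar>g w\<bar> + enn2real (h w)" by simp
    moreover have "ereal (g w) \<le> ereal (G j w)"
      using elim by (metis max.cobounded2)
    then have "g w \<le> G j w" by simp
    moreover have "0 \<le> enn2real (h w)" by simp
    ultimately show ?case unfolding real_norm_def by linarith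
  qed
  have lim: "AE w in completion P. (\<lambda>j. G j w) \<longlonglongrightarrow> g w"
  proof -
    obtain N where N: "N \<in> null_sets P"
      "\<And>w \<theta>s. w \<in> space P - N \<Longrightarrow> \<theta>s \<longlonglongrightarrow> \<theta> \<Longrightarrow> limsup (\<lambda>j. \<phi> (\<theta>s j) w) \<le> \<phi> \<theta> w"
      using usc unfolding as_usc_at_def by blast
    have "AE w in completion P. w \<in> space P - N"
      using AE_not_in[OF N(1)] AE_space[of P] by (auto simp: AE_completion_iff)
    moreover have "AE w in completion P. \<phi> \<theta> w \<le> ereal (g w)"
      using g by (simp add: AE_completion_iff)
    ultimately show ?thesis using AE_max_fin
    proof eventually_elim
      case (elim w)
      \<comment> \<open>If every ball contained a parameter with value above \<open>g w + e\<close>,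
        these parameters would form a sequence tending to \<open>\<theta>\<close> that violates
        upper semicontinuity at \<open>w\<close>.\<close>
      have "\<exists>j. S j w \<le> ereal (g w + e)" if "e > 0" for e
      proof (rule ccontr)
        assume "\<nexists>j. S j w \<le> ereal (g w + e)"
        then have "\<forall>j. \<exists>\<theta>'\<in>ball \<theta> (r j). ereal (g w + e) < \<phi> \<theta>' w"
          by (simp add: S_def not_le less_SUP_iff)
        then obtain \<theta>s where \<theta>s: "\<And>j. \<theta>s j \<in> ball \<theta> (r j)" "\<And>j. ereal (g w + e) < \<phi> (\<theta>s j) w"
          by metis
        have "\<theta>s \<longlonglongrightarrow> \<theta>"
        proof (rule metric_tendsto_imp_tendsto[where f = r and a = 0])
          show "r \<longlonglongrightarrow> 0" unfolding r_def[abs_def]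
            by (rule LIMSEQ_Suc) (rule lim_const_over_n)
          show "\<forall>\<^sub>F j in sequentially. dist (\<theta>s j) \<theta> \<le> dist (r j) 0"
            using \<theta>s(1) r by (auto simp: dist_commute less_imp_le)
        qed
        then have "limsup (\<lambda>j. \<phi> (\<theta>s j) w) \<le> ereal (g w)"
          using N(2) elim by (meson order_trans)
        moreover have "ereal (g w + e) \<le> limsup (\<lambda>j. \<phi> (\<theta>s j) w)"
          using \<theta>s(2) by (intro le_Limsup) (auto simp: less_imp_le)
        ultimately have "ereal (g w + e) \<le> ereal (g w)" by order
        then show False using that by simp
      qed
      then show ?case
        unfolding LIMSEQ_iff
      proof safe
        fix e :: real assume e: "\<And>e. e > 0 \<Longrightarrow> \<exists>j. S j w \<le> ereal (g w + e)" "e > 0"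
        then obtain j0 where j0: "S j0 w \<le> ereal (g w + e/2)"
          using half_gt_zero by blast
        show "\<exists>no. \<forall>n\<ge>no. norm (G n w - g w) < e"
        proof (intro exI allI impI)
          fix n assume "n \<ge> j0"
          then have "S n w \<le> ereal (g w + e/2)" using j0 S_antimono order_trans by blast
          then have "ereal (G n w) \<le> ereal (g w + e/2)"
            using elim \<open>e > 0\<close> by (metis max.bounded_iff ereal_less_eq(3) le_add_same_cancel1 half_gt_zero less_imp_le)
          moreover have "ereal (g w) \<le> ereal (G n w)"
            using elim by (metis max.cobounded2)
          ultimately show "norm (G n w - g w) < e" using \<open>e > 0\<close> by simp
        qed
      qed
    qed
  qed
  have "(\<lambda>j. integral\<^sup>L (completion P) (G j)) \<longlonglongrightarrow> integral\<^sup>L (completion P) g"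
    by (rule integral_dominated_convergence[where w = "\<lambda>w. \<bar>g w\<bar> + enn2real (h w)"])
       (use int_g int_h dom lim in auto)
  then have "eventually (\<lambda>j. integral\<^sup>L (completion P) (G j) < v) sequentially"
    using g(3) int_g by (intro order_tendstoD) auto
  then obtain j where j: "integral\<^sup>L (completion P) (G j) < v"
    using eventually_happens'[OF sequentially_bot] by blast
  have int_G: "integrable (completion P) (G j)"
    by (rule Bochner_Integration.integrable_bound[where f = "\<lambda>w. \<bar>g w\<bar> + enn2real (h w)"])
       (use int_g int_h dom[of j] in auto)
  \<comment> \<open>The suprema are measurable for the completion only. A version measurable for
    \<open>P\<close> itself is needed in order to compose the bound with blocks of the
    sample.\<close>
  obtain G' where G': "G' \<in> borel_measurable P" "AE w in P. G j w = G' w"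
    using completion_ex_borel_measurable_real[of "G j" P] by auto
  have G'_c: "G' \<in> borel_measurable (completion P)" using G'(1) by (rule measurable_completion)
  have AE_G': "AE w in completion P. G j w = G' w" using G' by (simp add: AE_completion_iff)
  have "integrable P G'"
    using integrable_cong_AE[OF _ G'_c AE_G'] int_G G'(1) by (simp add: integrable_completion)
  moreover have "integral\<^sup>L P G' < v"
    using integral_cong_AE[OF _ G'_c AE_G'] j G'(1) by (simp add: integral_completion)
  moreover have "AE w in P. \<forall>\<theta>'\<in>ball \<theta> (r j). \<phi> \<theta>' w \<le> ereal (G' w)"
    using AE_max_fin[unfolded AE_completion_iff] G'(2)
  proof eventually_elim
    case (elim w)
    show ?case
    proof
      fix \<theta>' assume "\<theta>' \<in> ball \<theta> (r j)"
      then have "\<phi> \<theta>' w \<le> max (S j w) (ereal (g w))"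
        by (intro max.coboundedI1 S_upper)
      then show "\<phi> \<theta>' w \<le> ereal (G' w)" using elim by metis
    qed
  qed
  ultimately show ?thesis using r(1) by blast
qed

text \<open>Controls the last block, whose contribution only has to be negligible, and the positive
  part at a maximizer. The bound is the positive part of the supremum; its sign prepares for
  Markov's inequality.\<close>

lemma wald_integrable_bound:
  fixes \<phi> :: "'t::metric_space \<Rightarrow> 'x \<Rightarrow> ereal"
  assumes wald: "wald_integrable_at P \<phi> \<theta>"
  shows "\<exists>\<rho>>0. \<exists>G. integrable P G \<and> (\<forall>w. 0 \<le> G w) \<and>
           (AE w in P. \<forall>\<theta>'\<in>ball \<theta> \<rho>. \<phi> \<theta>' w \<le> ereal (G w))"
proof -
  obtain \<delta> where "\<delta> > 0"
    and meas: "(\<lambda>w. SUP \<theta>'\<in>ball \<theta> \<delta>. \<phi> \<theta>' w) \<in> borel_measurable (completion P)"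
    and fin: "(\<integral>\<^sup>+ w. e2ennreal (max (SUP \<theta>'\<in>ball \<theta> \<delta>. \<phi> \<theta>' w) 0) \<partial>completion P) < \<infinity>"
    using wald unfolding wald_integrable_at_def by blast
  define h where "h w = e2ennreal (max (SUP \<theta>'\<in>ball \<theta> \<delta>. \<phi> \<theta>' w) 0)" for w
  have "h \<in> borel_measurable (completion P)"
    unfolding h_def using meas by measurable
  then obtain h' where [measurable]: "h' \<in> borel_measurable P" and h': "AE w in P. h w = h' w"
    using completion_ex_borel_measurable by blast
  have "integral\<^sup>N P h' = integral\<^sup>N P h"
    using h' by (intro nn_integral_cong_AE) auto
  also have "\<dots> < \<infinity>" using fin by (simp add: h_def[abs_def] nn_integral_completion)
  finally have h'_fin: "integral\<^sup>N P h' < \<infinity>" .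
  have AE_h': "AE w in P. h' w \<noteq> \<infinity>"
    using h'_fin by (intro nn_integral_PInf_AE) auto
  have "integrable P (\<lambda>w. enn2real (h' w))"
  proof (rule integrableI_bounded)
    have "(\<integral>\<^sup>+ w. ennreal (norm (enn2real (h' w))) \<partial>P) = integral\<^sup>N P h'"
      using AE_h' by (intro nn_integral_cong_AE) (auto simp: less_top)
    then show "(\<integral>\<^sup>+ w. ennreal (norm (enn2real (h' w))) \<partial>P) < \<infinity>"
      using h'_fin by simp
  qed auto
  moreover have "AE w in P. \<forall>\<theta>'\<in>ball \<theta> \<delta>. \<phi> \<theta>' w \<le> ereal (enn2real (h' w))"
    using AE_h' h'
  proof eventually_elim
    case (elim w)
    have "(SUP \<theta>'\<in>ball \<theta> \<delta>. \<phi> \<theta>' w) \<le> enn2ereal (h w)"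
      by (simp add: h_def enn2ereal_e2ennreal)
    also have "enn2ereal (h w) = ereal (enn2real (h' w))"
      using elim by (cases "h' w") (auto simp: enn2ereal_ennreal)
    finally show ?case by (auto simp: SUP_le_iff)
  qed
  ultimately show ?thesis using \<open>\<delta> > 0\<close> by (intro exI[of _ \<delta>] conjI exI[of _ "\<lambda>w. enn2real (h' w)"]) auto
qed

subsection \<open>Blocks of an iid sequence\<close>

text \<open>Injectivity makes the singletons \<open>{f i}\<close> disjoint, and disjoint groups of
  an independent family are independent; each group is then projected to its only
  coordinate.\<close>

lemma (in prob_space) indep_vars_inj_reindex:
  assumes ind: "indep_vars M' X J" and "inj_on f I" "f ` I \<subseteq> J"
  shows "indep_vars (\<lambda>i. M' (f i)) (\<lambda>i. X (f i)) I"
proof -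
  have "indep_vars (\<lambda>i. PiM {f i} M') (\<lambda>i \<omega>. restrict (\<lambda>j. X j \<omega>) {f i}) I"
    using assms by (intro indep_vars_restrict[OF ind]) (auto simp: disjoint_family_on_def inj_on_def)
  then have "indep_vars (\<lambda>i. M' (f i)) (\<lambda>i \<omega>. (\<lambda>x. x (f i)) (restrict (\<lambda>j. X j \<omega>) {f i})) I"
    by (rule indep_vars_compose2) (rule measurable_component_singleton, simp)
  then show ?thesis by simp
qed

locale iid_sequence = prob_space M for M :: "'w measure" +
  fixes A :: "'z measure" and Z :: "nat \<Rightarrow> 'w \<Rightarrow> 'z"
  assumes iid: "iid M A Z"
begin

lemma indep: "indep_vars (\<lambda>_. A) Z UNIV"
  using iid by (simp add: iid_def)

lemma Z_measurable[measurable]: "Z i \<in> measurable M A"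
  using indep by (auto simp: indep_vars_def)

lemma distr_Z: "distr M A (Z i) = distr M A (Z 0)"
  using iid by (simp add: iid_def)

text \<open>Shifting the sequence and keeping the index set \<open>{1..l}\<close> puts all blocks of
  one length into the same \<open>power_space A l\<close>. The block consists of the observations
  \<open>s + 1\<close> to \<open>s + l\<close>.\<close>

abbreviation block :: "nat \<Rightarrow> nat \<Rightarrow> 'w \<Rightarrow> nat \<Rightarrow> 'z" where
  "block l s \<equiv> sample (\<lambda>i. Z (s + i)) l"

lemma block_measurable[measurable]: "block l s \<in> measurable M (power_space A l)"
  unfolding sample_def by measurable

lemma sample_measurable[measurable]: "sample Z l \<in> measurable M (power_space A l)"
  using block_measurable[of 0 l] by simp

lemma block_in_space: "\<omega> \<in> space M \<Longrightarrow> block l s \<omega> \<in> space (power_space A l)"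
  using measurable_space[OF block_measurable] .

text \<open>Both sides are the \<open>l\<close>-fold product of the law of \<open>Z 0\<close>. Thus
  whatever is known about the law of the initial sample applies to every block.\<close>

lemma distr_block:
  assumes "l \<ge> 1"
  shows "distr M (power_space A l) (block l s) = distr M (power_space A l) (sample Z l)"
proof -
  have "distr M (power_space A l) (block l t) = (\<Pi>\<^sub>M i\<in>{1..l}. distr M A (Z 0))" for t
  proof -
    have "indep_vars (\<lambda>_. A) (\<lambda>i. Z (t + i)) {1..l}"
      by (rule indep_vars_inj_reindex[OF indep]) auto
    then have "distr M (power_space A l) (block l t) = (\<Pi>\<^sub>M i\<in>{1..l}. distr M A (Z (t + i)))"
      unfolding sample_def using assms
      by (subst (asm) indep_vars_iff_distr_eq_PiM') auto
    also have "\<dots> = (\<Pi>\<^sub>M i\<in>{1..l}. distr M A (Z 0))"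
      by (intro PiM_cong refl distr_Z)
    finally show ?thesis .
  qed
  from this[of s] this[of 0] show ?thesis by simp
qed

lemma AE_block:
  assumes "l \<ge> 1" "AE z in distr M (power_space A l) (sample Z l). Q z"
  shows "AE \<omega> in M. Q (block l s \<omega>)"
proof (rule AE_distrD[OF block_measurable])
  show "AE z in distr M (power_space A l) (block l s). Q z"
    by (subst distr_block[OF assms(1)]) (rule assms(2))
qed

lemma indep_blocks:
  assumes "k \<ge> 1"
  shows "indep_vars (\<lambda>_. power_space A k) (\<lambda>j. block k (j * k)) UNIV"
proof -
  let ?K = "\<lambda>j. {j * k + 1..j * k + k}"
  have "disjoint_family ?K"
  proof -
    \<comment> \<open>The block number can be read off from the index \<open>i\<close>, so no index
      lies in two blocks.\<close>
    have "(i - 1) div k = j" if "i \<in> ?K j" for i j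
    proof -
      have "(i - 1) div k = (j * k + (i - 1 - j * k)) div k" using that by simp
      also have "\<dots> = j" using that assms by (subst div_mult_self3) auto
      finally show ?thesis .
    qed
    then show ?thesis unfolding disjoint_family_on_def by blast
  qed
  then have "indep_vars (\<lambda>j. PiM (?K j) (\<lambda>_. A)) (\<lambda>j \<omega>. restrict (\<lambda>i. Z i \<omega>) (?K j)) UNIV"
    by (intro indep_vars_restrict[OF indep]) auto
  then have "indep_vars (\<lambda>_. power_space A k)
      (\<lambda>j \<omega>. (\<lambda>x. \<lambda>i\<in>{1..k}. x (j * k + i)) (restrict (\<lambda>i. Z i \<omega>) (?K j))) UNIV"
    by (rule indep_vars_compose2) (intro measurable_restrict measurable_component_singleton, simp)
  moreover have "(\<lambda>i\<in>{1..k}. (restrict (\<lambda>i. Z i \<omega>) (?K j)) (j * k + i)) = block k (j * k) \<omega>" for j \<omega>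
    by (auto simp: sample_def fun_eq_iff restrict_def)
  ultimately show ?thesis by simp
qed

lemma block_integral:
  fixes f :: "(nat \<Rightarrow> 'z) \<Rightarrow> real"
  assumes "l \<ge> 1" "integrable (distr M (power_space A l) (sample Z l)) f"
  shows "integrable M (\<lambda>\<omega>. f (block l s \<omega>))"
    and "expectation (\<lambda>\<omega>. f (block l s \<omega>)) = integral\<^sup>L (distr M (power_space A l) (sample Z l)) f"
proof -
  let ?P = "distr M (power_space A l) (block l s)"
  have f: "integrable ?P f" by (subst distr_block) (rule assms)+
  then show "integrable M (\<lambda>\<omega>. f (block l s \<omega>))" by (rule integrable_distr[OF block_measurable])
  have "f \<in> borel_measurable (power_space A l)" using f by auto
  then show "expectation (\<lambda>\<omega>. f (block l s \<omega>)) = integral\<^sup>L (distr M (power_space A l) (sample Z l)) f"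
    using integral_distr[OF block_measurable, of f l s] unfolding distr_block[OF assms(1)] by simp
qed

section \<open>From block sums to the positive part of a single summand\<close>

lemma nn_integral_Z:
  assumes [measurable]: "f \<in> borel_measurable A"
  shows "(\<integral>\<^sup>+ \<omega>. f (Z i \<omega>) \<partial>M) = (\<integral>\<^sup>+ \<omega>. f (Z 0 \<omega>) \<partial>M)"
proof -
  have "(\<integral>\<^sup>+ \<omega>. f (Z i \<omega>) \<partial>M) = integral\<^sup>N (distr M A (Z i)) f" for i
    by (rule nn_integral_distr[symmetric]) auto
  then show ?thesis by (metis distr_Z)
qed

text \<open>
  On the event that the other summands exceed a constant \<open>-c\<close>, which is independent of the first
  summand and has positive probability, the sum is bounded below by the first summand up to a
  constant.
\<close>

lemma nn_integral_pos_part_finite: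
  fixes f :: "'z \<Rightarrow> ereal"
  assumes [measurable]: "f \<in> borel_measurable A" and "k \<ge> 1"
    and H: "integrable M H" "AE \<omega> in M. (\<Sum>i=1..k. f (Z i \<omega>)) \<le> ereal (H \<omega>)"
  shows "(\<integral>\<^sup>+ \<omega>. e2ennreal (f (Z 0 \<omega>)) \<partial>M) < \<infinity>"
proof (cases "\<exists>c::nat. (\<integral>\<^sup>+ \<omega>. indicator {- ereal (real c)<..} (f (Z 0 \<omega>)) \<partial>M) \<noteq> 0")
  \<comment> \<open>Here \<open>f (Z 0)\<close> is almost surely at most 0, as the level
    \<open>c = 0\<close> already shows, and its positive part vanishes.\<close>
  case False
  then have "AE \<omega> in M. \<forall>c::nat. indicator {- ereal (real c)<..} (f (Z 0 \<omega>)) = (0::ennreal)"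
    by (subst AE_all_countable) (auto simp: nn_integral_0_iff_AE)
  then have "AE \<omega> in M. e2ennreal (f (Z 0 \<omega>)) = 0"
  proof eventually_elim
    case (elim \<omega>)
    then have "\<not> - ereal (real 0) < f (Z 0 \<omega>)" by (metis indicator_simps(1) greaterThan_iff zero_neq_one)
    then show ?case by (simp add: e2ennreal_neg zero_ereal_def)
  qed
  then have "(\<integral>\<^sup>+ \<omega>. e2ennreal (f (Z 0 \<omega>)) \<partial>M) = 0"
    by (subst nn_integral_0_iff_AE) auto
  then show ?thesis by simp
next
  case True
  then obtain c :: nat where c: "(\<integral>\<^sup>+ \<omega>. indicator {- ereal (real c)<..} (f (Z 0 \<omega>)) \<partial>M) \<noteq> 0"
    by blast
  \<comment> \<open>\<open>-C\<close> is the lower bound for the sum of the other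
    \<open>k - 1\<close> summands when each exceeds \<open>-c\<close>. The product of the
    \<open>h i\<close> is the positive part of the first summand minus \<open>C\<close>, restricted
    to that event; it lies below \<open>H\<close>, and independence factorizes its integral.\<close>
  define C where "C = real (k - 1) * real c"
  define h :: "nat \<Rightarrow> ereal \<Rightarrow> ennreal"
    where "h i x = (if i = 1 then e2ennreal (x - ereal C) else indicator {- ereal (real c)<..} x)" for i x
  have [measurable]: "h i \<in> borel_measurable borel" for i
    unfolding h_def by (cases "i = 1") simp_all
  have set_eq: "{1..k} = insert 1 {2..k}" using \<open>k \<ge> 1\<close> by auto
  have "(\<Prod>i=1..k. \<integral>\<^sup>+ \<omega>. h i (f (Z i \<omega>)) \<partial>M) = (\<integral>\<^sup>+ \<omega>. (\<Prod>i=1..k. h i (f (Z i \<omega>))) \<partial>M)"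
  proof (rule indep_vars_nn_integral[symmetric])
    show "indep_vars (\<lambda>_. borel) (\<lambda>i \<omega>. h i (f (Z i \<omega>))) {1..k}"
      by (rule indep_vars_compose2[OF indep_vars_subset[OF indep]]) auto
  qed auto
  also have "\<dots> \<le> (\<integral>\<^sup>+ \<omega>. ennreal (H \<omega>) \<partial>M)"
    using H(2)
  proof (intro nn_integral_mono_AE, eventually_elim)
    case (elim \<omega>)
    show ?case
    proof (cases "\<forall>i\<in>{2..k}. f (Z i \<omega>) > - ereal (real c)")
      case True
      have "(\<Prod>i=1..k. h i (f (Z i \<omega>))) = h 1 (f (Z 1 \<omega>)) * (\<Prod>i=2..k. h i (f (Z i \<omega>)))"
        unfolding set_eq by simp
      also have "(\<Prod>i=2..k. h i (f (Z i \<omega>))) = 1"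
        using True by (intro prod.neutral) (auto simp: h_def)
      finally have "(\<Prod>i=1..k. h i (f (Z i \<omega>))) = e2ennreal (f (Z 1 \<omega>) - ereal C)"
        by (simp add: h_def)
      moreover have "f (Z 1 \<omega>) - ereal C \<le> ereal (H \<omega>)"
      proof -
        have "(\<Sum>i=2..k. - ereal (real c)) \<le> (\<Sum>i=2..k. f (Z i \<omega>))"
          using True by (intro sum_mono) (auto simp: less_imp_le)
        moreover have "(\<Sum>i=2..k. - ereal (real c)) = - ereal C"
          using \<open>k \<ge> 1\<close> by (simp add: C_def of_nat_diff)
        ultimately have "f (Z 1 \<omega>) + - ereal C \<le> f (Z 1 \<omega>) + (\<Sum>i=2..k. f (Z i \<omega>))"
          by (intro add_left_mono) simp
        also have "\<dots> = (\<Sum>i=1..k. f (Z i \<omega>))" unfolding set_eq by simp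
        finally show ?thesis using elim by (simp add: minus_ereal_def)
      qed
      ultimately show ?thesis
        using e2ennreal_mono by (metis e2ennreal_ereal)
    next
      case False
      then obtain i where "i \<in> {2..k}" "\<not> f (Z i \<omega>) > - ereal (real c)" by blast
      then have "(\<Prod>i=1..k. h i (f (Z i \<omega>))) = 0"
        by (intro prod_zero bexI[of _ i]) (auto simp: h_def)
      then show ?thesis by (simp only: zero_le)
    qed
  qed
  also have "\<dots> < \<infinity>" using integrableD(2)[OF H(1)]
    by (metis H(1) infinity_ennreal_def integrable_iff_bounded less_top nn_integral_mono order_le_less_trans real_norm_def abs_ge_self ennreal_leI)
  finally have "(\<Prod>i=1..k. \<integral>\<^sup>+ \<omega>. h i (f (Z i \<omega>)) \<partial>M) < \<infinity>" .
  then have *: "(\<integral>\<^sup>+ \<omega>. h 1 (f (Z 1 \<omega>)) \<partial>M) * (\<Prod>i=2..k. \<integral>\<^sup>+ \<omega>. h i (f (Z i \<omega>)) \<partial>M) < \<infinity>"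
    unfolding set_eq by simp
  \<comment> \<open>Each of these factors is the probability that \<open>f (Z i)\<close> exceeds
    \<open>-c\<close>, positive by the choice of \<open>c\<close>. Finiteness of the product thus
    passes to the first factor.\<close>
  moreover have "(\<Prod>i=2..k. \<integral>\<^sup>+ \<omega>. h i (f (Z i \<omega>)) \<partial>M) \<noteq> 0"
  proof -
    have "(\<integral>\<^sup>+ \<omega>. h i (f (Z i \<omega>)) \<partial>M) \<noteq> 0" if "i \<in> {2..k}" for i
      using that c nn_integral_Z[of "\<lambda>z. h i (f z)" i] by (simp add: h_def)
    then show ?thesis by simp
  qed
  ultimately have "(\<integral>\<^sup>+ \<omega>. h 1 (f (Z 1 \<omega>)) \<partial>M) < \<infinity>"
    by (auto simp: ennreal_mult_less_top less_top)
  then have fin: "(\<integral>\<^sup>+ \<omega>. h 1 (f (Z 0 \<omega>)) \<partial>M) < \<infinity>"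
    using nn_integral_Z[of "\<lambda>z. h 1 (f z)" 1] by simp
  have "(\<integral>\<^sup>+ \<omega>. e2ennreal (f (Z 0 \<omega>)) \<partial>M) \<le> (\<integral>\<^sup>+ \<omega>. h 1 (f (Z 0 \<omega>)) + ennreal C \<partial>M)"
  proof (intro nn_integral_mono)
    fix \<omega>
    have "C \<ge> 0" by (simp add: C_def)
    have "e2ennreal x \<le> e2ennreal (x - ereal C) + ennreal C" for x
    proof (cases x)
      case (real r)
      have "ennreal r \<le> ennreal (max (r - C) 0 + C)" by (intro ennreal_leI) auto
      also have "\<dots> = ennreal (max (r - C) 0) + ennreal C" using \<open>C \<ge> 0\<close> by (intro ennreal_plus) auto
      also have "ennreal (max (r - C) 0) = ennreal (r - C)" by (simp add: max_def ennreal_neg)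
      finally show ?thesis using real by simp
    qed (auto simp: e2ennreal_neg)
    then show "e2ennreal (f (Z 0 \<omega>)) \<le> h 1 (f (Z 0 \<omega>)) + ennreal C" by (simp add: h_def)
  qed
  also have "\<dots> = (\<integral>\<^sup>+ \<omega>. h 1 (f (Z 0 \<omega>)) \<partial>M) + ennreal C"
    by (subst nn_integral_add) (auto simp: emeasure_space_1)
  also have "\<dots> < \<infinity>" using fin by simp
  finally show ?thesis .
qed

end

section \<open>Arithmetic of cutting a sample into blocks\<close>

lemma sum_blocks:
  fixes f :: "nat \<Rightarrow> 'a::comm_monoid_add"
  shows "(\<Sum>i=1..q * k + l. f i) = (\<Sum>j<q. \<Sum>i=1..k. f (j * k + i)) + (\<Sum>i=1..l. f (q * k + i))"
proof (induction q arbitrary: l)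
  case (Suc q)
  \<comment> \<open>Since \<open>Suc q * k + l = q * k + (k + l)\<close>, the induction hypothesis
    is used with a last block of length \<open>k + l\<close>, from which a block of length
    \<open>k\<close> is then split off.\<close>
  have split: "(\<Sum>i=1..k + l. g i) = (\<Sum>i=1..k. g i) + (\<Sum>i=1..l. g (k + i))" for g :: "nat \<Rightarrow> 'a"
    by (induction l) (simp_all add: add.assoc)
  show ?case
    using Suc[of "k + l"] split[of "\<lambda>i. f (q * k + i)"] by (simp add: ac_simps)
qed simp

text \<open>One full block is taken from the quotient and joined to the remainder, which puts the
  length of the last block in the range where \<open>mbar\<close> is available.\<close>

lemma block_decomposition:
  fixes k n :: nat
  assumes "k \<ge> 1" "n \<ge> k"
  shows "n = (n div k - 1) * k + (k + n mod k)" "k + n mod k \<in> {k..2 * k - 1}"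
proof -
  have "n div k \<ge> 1" using assms by (simp add: Suc_le_eq div_greater_zero_iff)
  then have "(n div k - 1) * k + k = n div k * k"
    by (metis add.commute diff_add mult_Suc plus_1_eq_Suc le_add_diff_inverse)
  then show "n = (n div k - 1) * k + (k + n mod k)"
    by (metis add.assoc div_mult_mod_eq)
  have "n mod k < k" using assms by simp
  then show "k + n mod k \<in> {k..2 * k - 1}" by auto
qed

section \<open>Weak laws for observations and for blocks\<close>

context iid_sequence
begin

lemma weak_law_Z:
  fixes f :: "'z \<Rightarrow> real"
  assumes [measurable]: "f \<in> borel_measurable A" and "integrable M (\<lambda>\<omega>. f (Z 0 \<omega>))" "\<eta> > 0"
  shows "(\<lambda>n. prob {\<omega> \<in> space M. \<bar>(\<Sum>i=1..n. f (Z i \<omega>)) / real n - expectation (\<lambda>\<omega>. f (Z 0 \<omega>))\<bar> \<ge> \<eta>}) \<longlonglongrightarrow> 0"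
proof -
  have distr_f: "distr M borel (\<lambda>\<omega>. f (Z i \<omega>)) = distr (distr M A (Z 0)) borel f" for i
    unfolding distr_Z[of i, symmetric] by (subst distr_distr) (auto simp: comp_def)
  have eq: "integrable M (\<lambda>\<omega>. f (Z i \<omega>)) \<longleftrightarrow> integrable (distr M A (Z 0)) f"
     "expectation (\<lambda>\<omega>. f (Z i \<omega>)) = integral\<^sup>L (distr M A (Z 0)) f" for i
    unfolding distr_Z[of i, symmetric] by (auto simp: integrable_distr_eq integral_distr)
  \<comment> \<open>The general law starts at index 0, whereas the sample starts at
    \<open>Z 1\<close>; hence the shift by \<open>Suc\<close>.\<close>
  have "(\<lambda>n. prob {\<omega> \<in> space M. \<bar>(\<Sum>i<n. f (Z (Suc i) \<omega>)) / real n - expectation (\<lambda>\<omega>. f (Z (Suc 0) \<omega>))\<bar> \<ge> \<eta>}) \<longlonglongrightarrow> 0"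
  proof (rule weak_law_of_large_numbers)
    show "indep_vars (\<lambda>_. borel) (\<lambda>i \<omega>. f (Z (Suc i) \<omega>)) UNIV"
      by (rule indep_vars_compose2[OF indep_vars_inj_reindex[OF indep]]) auto
  qed (use assms eq distr_f in auto)
  moreover have "(\<Sum>i=1..n. f (Z i \<omega>)) = (\<Sum>i<n. f (Z (Suc i) \<omega>))" for n \<omega>
    by (simp add: sum.atLeast1_atMost_eq)
  ultimately show ?thesis by (simp only: eq(2))
qed

lemma weak_law_block:
  fixes G :: "(nat \<Rightarrow> 'z) \<Rightarrow> real"
  assumes "k \<ge> 1" and G: "integrable (distr M (power_space A k) (sample Z k)) G" and "\<eta> > 0"
  shows "(\<lambda>q. prob {\<omega> \<in> space M. \<bar>(\<Sum>j<q. G (block k (j * k) \<omega>)) / real q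
           - integral\<^sup>L (distr M (power_space A k) (sample Z k)) G\<bar> \<ge> \<eta>}) \<longlonglongrightarrow> 0"
proof -
  let ?P = "distr M (power_space A k) (sample Z k)"
  have G_meas[measurable]: "G \<in> borel_measurable (power_space A k)" using G by auto
  have distr_G: "distr M borel (\<lambda>\<omega>. G (block k s \<omega>)) = distr ?P borel G" for s
    unfolding distr_block[OF assms(1), of s, symmetric]
    by (subst distr_distr[OF G_meas block_measurable]) (simp add: comp_def)
  have "(\<lambda>q. prob {\<omega> \<in> space M. \<bar>(\<Sum>j<q. G (block k (j * k) \<omega>)) / real q
           - expectation (\<lambda>\<omega>. G (block k (0 * k) \<omega>))\<bar> \<ge> \<eta>}) \<longlonglongrightarrow> 0"
  proof (rule weak_law_of_large_numbers)
    show "indep_vars (\<lambda>_. borel) (\<lambda>j \<omega>. G (block k (j * k) \<omega>)) UNIV"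
      by (rule indep_vars_compose2[OF indep_blocks]) (use assms in auto)
    show "distr M borel (\<lambda>\<omega>. G (block k (i * k) \<omega>)) = distr M borel (\<lambda>\<omega>. G (block k (0 * k) \<omega>))" for i
      unfolding distr_G ..
    show "integrable M (\<lambda>\<omega>. G (block k (0 * k) \<omega>))"
      by (rule block_integral) fact+
  qed fact
  then show ?thesis
    unfolding block_integral(2)[OF assms(1) G] .
qed

subsection \<open>Consistency\<close>

text \<open>The set \<open>B\<close> will be a small ball. An estimator in \<open>B\<close> would
  keep the criterion below \<open>v\<close> by a fixed gap, while near-maximality keeps it close to
  \<open>v\<close>; both can hold only on the exceptional events \<open>E n\<close>. These are
  measurable, unlike possibly the event that the estimator lies in \<open>B\<close>.\<close>

lemma estimator_escapes_set:
  fixes m :: "'t \<Rightarrow> 'z \<Rightarrow> ereal" and mbar :: "nat \<Rightarrow> 't \<Rightarrow> (nat \<Rightarrow> 'z) \<Rightarrow> ereal"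
    and \<theta>hat :: "nat \<Rightarrow> 'w \<Rightarrow> 't" and G :: "(nat \<Rightarrow> 'z) \<Rightarrow> real" and H :: "nat \<Rightarrow> (nat \<Rightarrow> 'z) \<Rightarrow> real"
  defines "Q \<equiv> \<lambda>l. distr M (power_space A l) (sample Z l)"
  assumes k: "k \<ge> 1"
    and mbar_eq: "\<And>l \<theta> z. l \<in> {k..2*k-1} \<Longrightarrow> \<theta> \<in> T \<Longrightarrow> z \<in> space (power_space A l) \<Longrightarrow>
           mbar l \<theta> z = mean m l \<theta> z"
    and m_meas: "m \<theta>\<^sub>0 \<in> borel_measurable A"
    and m_fin: "AE \<omega> in M. \<forall>i. \<bar>m \<theta>\<^sub>0 (Z i \<omega>)\<bar> \<noteq> \<infinity>"
    and m_int: "integrable M (\<lambda>\<omega>. real_of_ereal (m \<theta>\<^sub>0 (Z 0 \<omega>)))"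
    and G_int: "integrable (Q k) G"
    and less: "integral\<^sup>L (Q k) G < expectation (\<lambda>\<omega>. real_of_ereal (m \<theta>\<^sub>0 (Z 0 \<omega>)))"
    and G_bound: "AE z in Q k. \<forall>\<theta>\<in>B. mbar k \<theta> z \<le> ereal (G z)"
    and H_int: "\<And>l. l \<in> {k..2*k-1} \<Longrightarrow> integrable (Q l) (H l)"
    and H_nonneg: "\<And>l z. l \<in> {k..2*k-1} \<Longrightarrow> 0 \<le> H l z"
    and H_bound: "\<And>l. l \<in> {k..2*k-1} \<Longrightarrow> AE z in Q l. \<forall>\<theta>\<in>B. mbar l \<theta> z \<le> ereal (H l z)"
    and hat: "\<And>n \<omega>. n \<ge> 1 \<Longrightarrow> \<omega> \<in> space M \<Longrightarrow> \<theta>hat n \<omega> \<in> T"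
    and near: "near_maximizer M (\<lambda>n \<theta> \<omega>. mean m n \<theta> (\<lambda>i. Z i \<omega>)) \<theta>hat \<theta>\<^sub>0"
  shows "\<exists>E. (\<forall>n. E n \<in> sets M) \<and> (\<forall>\<^sub>F n in sequentially. {\<omega> \<in> space M. \<theta>hat n \<omega> \<in> B} \<subseteq> E n) \<and>
           (\<lambda>n. prob (E n)) \<longlonglongrightarrow> 0"
proof -
  define X where "X z = real_of_ereal (m \<theta>\<^sub>0 z)" for z
  have X_meas[measurable]: "X \<in> borel_measurable A"
    unfolding X_def using m_meas by measurable
  define v where "v = expectation (\<lambda>\<omega>. X (Z 0 \<omega>))"
  define a where "a = integral\<^sup>L (Q k) G"
  \<comment> \<open>Five errors of size \<open>\<eta>\<close> will occur: the law of large numbers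
    at \<open>\<theta>\<^sub>0\<close>, the slack \<open>\<rho>\<close>, the last block, the law of
    large numbers for blocks, and the weight of the complete blocks. A sixth part of the gap leaves
    a contradiction.\<close>
  define \<eta> where "\<eta> = (v - a) / 6"
  have \<eta>: "\<eta> > 0" using less by (simp add: \<eta>_def v_def a_def X_def)
  have G_meas[measurable]: "G \<in> borel_measurable (power_space A k)"
    using G_int by (auto simp: Q_def)
  have H_meas[measurable]: "H l \<in> borel_measurable (power_space A l)" if "l \<in> {k..2*k-1}" for l
    using H_int[OF that] by (auto simp: Q_def)
  define len where "len n = k + n mod k" for n
  define q where "q n = n div k - 1" for n
  have len: "len n \<in> {k..2*k-1}" for n
  proof -
    have "n mod k < k" using k by simp
    then show ?thesis unfolding len_def by auto
  qed
  have n_eq: "n = q n * k + len n" if "n \<ge> k" for n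
    unfolding q_def len_def using block_decomposition k that by blast
  obtain \<rho> :: "nat \<Rightarrow> 'w \<Rightarrow> ereal" where \<rho>_all: "\<forall>n\<ge>1. \<rho> n \<in> borel_measurable M"
    "\<forall>n\<ge>1. \<forall>\<omega>\<in>space M. 0 \<le> \<rho> n \<omega> \<and>
        mean m n (\<theta>hat n \<omega>) (\<lambda>i. Z i \<omega>) \<ge> mean m n \<theta>\<^sub>0 (\<lambda>i. Z i \<omega>) - \<rho> n \<omega>"
    "\<forall>\<eta>>0. (\<lambda>n. prob {\<omega> \<in> space M. \<rho> n \<omega> > ereal \<eta>}) \<longlonglongrightarrow> 0"
    using near unfolding near_maximizer_def by blast
  have \<rho>_meas: "\<rho> n \<in> borel_measurable M"
    and \<rho>: "\<And>\<omega>. \<omega> \<in> space M \<Longrightarrow> 0 \<le> \<rho> n \<omega> \<and>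
        mean m n (\<theta>hat n \<omega>) (\<lambda>i. Z i \<omega>) \<ge> mean m n \<theta>\<^sub>0 (\<lambda>i. Z i \<omega>) - \<rho> n \<omega>"
    if "n \<ge> 1" for n
    using \<rho>_all that by blast+

  \<comment> \<open>One null set must serve all blocks. The possibly uncountable quantifier over
    \<open>B\<close> stays inside the almost sure statements; only the countably many starting
    points and finitely many lengths are moved in.\<close>
  have "AE \<omega> in M. (\<forall>i. \<bar>m \<theta>\<^sub>0 (Z i \<omega>)\<bar> \<noteq> \<infinity>) \<and>
      (\<forall>s. \<forall>\<theta>\<in>B. mbar k \<theta> (block k s \<omega>) \<le> ereal (G (block k s \<omega>))) \<and>
      (\<forall>s. \<forall>l\<in>{k..2*k-1}. \<forall>\<theta>\<in>B. mbar l \<theta> (block l s \<omega>) \<le> ereal (H l (block l s \<omega>)))"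
  proof (intro AE_conjI m_fin)
    show "AE \<omega> in M. \<forall>s. \<forall>\<theta>\<in>B. mbar k \<theta> (block k s \<omega>) \<le> ereal (G (block k s \<omega>))"
      unfolding AE_all_countable using AE_block[OF k G_bound[unfolded Q_def]] by blast
    have H_block: "AE \<omega> in M. \<forall>\<theta>\<in>B. mbar l \<theta> (block l s \<omega>) \<le> ereal (H l (block l s \<omega>))"
      if "l \<in> {k..2*k-1}" for l s
    proof (rule AE_block)
      show "l \<ge> 1" using that k by auto
    qed (rule H_bound[OF that, unfolded Q_def])
    have "AE \<omega> in M. \<forall>l\<in>{k..2*k-1}. \<forall>\<theta>\<in>B. mbar l \<theta> (block l s \<omega>) \<le> ereal (H l (block l s \<omega>))" for s
      by (rule AE_finite_allI[OF finite_atLeastAtMost H_block])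
    then show "AE \<omega> in M. \<forall>s. \<forall>l\<in>{k..2*k-1}. \<forall>\<theta>\<in>B. mbar l \<theta> (block l s \<omega>) \<le> ereal (H l (block l s \<omega>))"
      unfolding AE_all_countable by blast
  qed
  then obtain N where good: "\<And>\<omega>. \<omega> \<in> space M - N \<Longrightarrow> (\<forall>i. \<bar>m \<theta>\<^sub>0 (Z i \<omega>)\<bar> \<noteq> \<infinity>) \<and>
      (\<forall>s. \<forall>\<theta>\<in>B. mbar k \<theta> (block k s \<omega>) \<le> ereal (G (block k s \<omega>))) \<and>
      (\<forall>s. \<forall>l\<in>{k..2*k-1}. \<forall>\<theta>\<in>B. mbar l \<theta> (block l s \<omega>) \<le> ereal (H l (block l s \<omega>)))"
    and N: "N \<in> null_sets M"
    by (rule AE_E3) blast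

  define E1 where "E1 n = {\<omega> \<in> space M. \<bar>(\<Sum>i=1..n. X (Z i \<omega>)) / real n - v\<bar> \<ge> \<eta>}" for n
  \<comment> \<open>\<open>near_maximizer\<close> constrains \<open>\<rho> n\<close> for
    \<open>n \<ge> 1\<close> only, so \<open>E2 0\<close> is set to the empty set to be
    measurable.\<close>
  define E2 where "E2 n = (if n \<ge> 1 then {\<omega> \<in> space M. \<rho> n \<omega> > ereal \<eta>} else {})" for n
  define E3 where "E3 n = {\<omega> \<in> space M. \<bar>(\<Sum>j<n. G (block k (j * k) \<omega>)) / real n - a\<bar> \<ge> \<eta>}" for n
  define E4 where "E4 n = {\<omega> \<in> space M. real (len n) * H (len n) (block (len n) (q n * k) \<omega>) \<ge> real n * \<eta>}" for n
  have E_meas: "E1 n \<in> sets M" "E2 n \<in> sets M" "E3 n \<in> sets M" "E4 n \<in> sets M" for n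
  proof -
    show "E1 n \<in> sets M" unfolding E1_def by measurable
    show "E2 n \<in> sets M" unfolding E2_def using \<rho>_meas[of n, measurable] by simp
    show "E3 n \<in> sets M" unfolding E3_def by measurable
    note H_meas[OF len[of n], measurable]
    show "E4 n \<in> sets M" unfolding E4_def by measurable
  qed
  have E1: "(\<lambda>n. prob (E1 n)) \<longlonglongrightarrow> 0"
    unfolding E1_def v_def by (rule weak_law_Z[OF X_meas _ \<eta>]) (use m_int in \<open>simp add: X_def\<close>)
  have E2: "(\<lambda>n. prob (E2 n)) \<longlonglongrightarrow> 0"
  proof (rule Lim_transform_eventually[OF \<rho>_all(3)[rule_format, OF \<eta>]])
    show "\<forall>\<^sub>F n in sequentially. prob {\<omega> \<in> space M. \<rho> n \<omega> > ereal \<eta>} = prob (E2 n)"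
      using eventually_ge_at_top[of 1] by eventually_elim (simp add: E2_def)
  qed
  \<comment> \<open>\<open>E3\<close> is indexed by the number of blocks, so its weak law has to be
    read along \<open>q n\<close>.\<close>
  have q_lim: "filterlim q at_top sequentially"
    unfolding filterlim_at_top
  proof
    fix c
    show "\<forall>\<^sub>F n in sequentially. c \<le> q n"
      using eventually_ge_at_top[of "(c + 1) * k"]
    proof eventually_elim
      case (elim n)
      then have "c + 1 \<le> n div k" using k by (simp add: less_eq_div_iff_mult_less_eq)
      then show ?case by (simp add: q_def)
    qed
  qed
  have E3: "(\<lambda>n. prob (E3 (q n))) \<longlonglongrightarrow> 0"
  proof (rule filterlim_compose[OF _ q_lim])
    show "(\<lambda>n. prob (E3 n)) \<longlonglongrightarrow> 0"
      unfolding E3_def a_def Q_def using k G_int \<eta> by (intro weak_law_block) (auto simp: Q_def)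
  qed
  \<comment> \<open>The length of the last block varies with \<open>n\<close>. Summing over all
    finitely many lengths gives one constant, so that Markov's inequality at level
    \<open>n \<eta>\<close> decays like \<open>1/n\<close>.\<close>
  define C where "C = (\<Sum>l\<in>{k..2*k-1}. real l * integral\<^sup>L (Q l) (H l)) / \<eta>"
  have E4_bound: "prob (E4 n) \<le> C * inverse (real n)" if "n \<ge> 1" for n
  proof -
    have "len n \<ge> 1" using len[of n] k by auto
    note int = block_integral[OF this H_int[OF len, unfolded Q_def], of "q n * k"]
    have "prob (E4 n) \<le> expectation (\<lambda>\<omega>. real (len n) * H (len n) (block (len n) (q n * k) \<omega>)) / (real n * \<eta>)"
      unfolding E4_def using int(1) H_nonneg[OF len] \<eta> that
      by (intro integral_Markov_inequality_measure[where A = "{}"]) auto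
    also have "expectation (\<lambda>\<omega>. real (len n) * H (len n) (block (len n) (q n * k) \<omega>))
        = real (len n) * integral\<^sup>L (Q (len n)) (H (len n))"
      using int by (simp add: Q_def)
    also have "\<dots> \<le> (\<Sum>l\<in>{k..2*k-1}. real l * integral\<^sup>L (Q l) (H l))"
      using len[of n] H_nonneg by (intro member_le_sum) (auto intro!: mult_nonneg_nonneg Bochner_Integration.integral_nonneg)
    finally show ?thesis
      using \<eta> that by (simp add: C_def field_simps divide_right_mono)
  qed
  have E4: "(\<lambda>n. prob (E4 n)) \<longlonglongrightarrow> 0"
  proof (rule tendsto_sandwich[where f = "\<lambda>_. 0" and h = "\<lambda>n. C * inverse (real n)"])
    show "(\<lambda>n. C * inverse (real n)) \<longlonglongrightarrow> 0"
      by (rule tendsto_mult_right_zero[OF lim_inverse_n])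
    show "\<forall>\<^sub>F n in sequentially. prob (E4 n) \<le> C * inverse (real n)"
      using eventually_ge_at_top[of 1] by eventually_elim (rule E4_bound)
  qed auto

  define E where "E n = N \<union> (E1 n \<union> (E2 n \<union> (E3 (q n) \<union> E4 n)))" for n
  have E_sets: "E n \<in> sets M" for n
    unfolding E_def using E_meas N by auto
  have E_le: "prob (E n) \<le> prob (E1 n) + (prob (E2 n) + (prob (E3 (q n)) + prob (E4 n)))" for n
  proof -
    have "prob (E n) = prob (E1 n \<union> (E2 n \<union> (E3 (q n) \<union> E4 n)))"
      unfolding E_def using E_meas N by (subst Un_commute, intro measure_Un_null_set) auto
    also have "\<dots> \<le> prob (E1 n) + prob (E2 n \<union> (E3 (q n) \<union> E4 n))"
      using E_meas by (intro measure_Un_le) auto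
    also have "prob (E2 n \<union> (E3 (q n) \<union> E4 n)) \<le> prob (E2 n) + prob (E3 (q n) \<union> E4 n)"
      using E_meas by (intro measure_Un_le) auto
    also have "prob (E3 (q n) \<union> E4 n) \<le> prob (E3 (q n)) + prob (E4 n)"
      using E_meas by (intro measure_Un_le) auto
    finally show ?thesis by simp
  qed
  have "(\<lambda>n. prob (E1 n) + (prob (E2 n) + (prob (E3 (q n)) + prob (E4 n)))) \<longlonglongrightarrow> 0"
    using tendsto_add[OF E1 tendsto_add[OF E2 tendsto_add[OF E3 E4]]] by simp
  from tendsto_sandwich[OF _ _ tendsto_const this, of "\<lambda>n. prob (E n)"]
  have E_lim: "(\<lambda>n. prob (E n)) \<longlonglongrightarrow> 0"
    using E_le by simp

  \<comment> \<open>The complete blocks have total weight \<open>1 - len n / n\<close> rather than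
    1. As \<open>len n \<le> 2 k\<close>, this null sequence bounds the resulting error.\<close>
  have "(\<lambda>n. \<bar>a + \<eta>\<bar> * (2 * real k) * inverse (real n)) \<longlonglongrightarrow> 0"
    by (rule tendsto_mult_right_zero[OF lim_inverse_n])
  then have "\<forall>\<^sub>F n in sequentially. \<bar>a + \<eta>\<bar> * (2 * real k) * inverse (real n) < \<eta>"
    using \<eta> by (rule order_tendstoD)
  moreover have "\<forall>\<^sub>F n in sequentially. n \<ge> 2 * k" by (rule eventually_ge_at_top)
  ultimately have "\<forall>\<^sub>F n in sequentially. {\<omega> \<in> space M. \<theta>hat n \<omega> \<in> B} \<subseteq> E n"
  proof eventually_elim
    case (elim n)
    have n: "n \<ge> 1" "n \<ge> k" "real n > 0" using elim k by auto
    have "q n \<ge> 1"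
    proof -
      have "2 \<le> n div k" using elim k by (simp add: less_eq_div_iff_mult_less_eq)
      then show ?thesis by (simp add: q_def)
    qed
    then have q: "real (q n) > 0" by simp
    show ?case
    proof (intro subsetI, rule ccontr)
      fix \<omega> assume w: "\<omega> \<in> {\<omega> \<in> space M. \<theta>hat n \<omega> \<in> B}" "\<omega> \<notin> E n"
      define \<theta> where "\<theta> = \<theta>hat n \<omega>"
      have \<theta>: "\<theta> \<in> B" "\<theta> \<in> T" and w_space: "\<omega> \<in> space M" "\<omega> \<in> space M - N"
        using w hat n by (auto simp: \<theta>_def E_def)
      define SX where "SX = (\<Sum>i=1..n. X (Z i \<omega>))"
      define SG where "SG = (\<Sum>j<q n. G (block k (j * k) \<omega>))"
      define L where "L = real (len n) * H (len n) (block (len n) (q n * k) \<omega>)"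
      have ev1: "SX / real n > v - \<eta>"
        using w w_space by (auto simp: E_def E1_def SX_def)
      have ev2: "\<rho> n \<omega> \<le> ereal \<eta>"
        using w w_space n by (auto simp: E_def E2_def)
      have ev3: "SG / real (q n) < a + \<eta>"
        using w w_space by (auto simp: E_def E3_def SG_def)
      have ev4: "L < real n * \<eta>"
        using w w_space by (auto simp: E_def E4_def L_def)
      \<comment> \<open>Because the estimator takes values in \<open>T\<close>, \<open>mbar\<close>
        of a block is its mean, and a bound on it becomes a bound on the block sum.\<close>
      have block_sum: "(\<Sum>i=1..l. m \<theta> (Z (s + i) \<omega>)) \<le> ereal (real l * c)"
        if l: "l \<in> {k..2*k-1}" and c: "mbar l \<theta> (block l s \<omega>) \<le> ereal c" for l s c
      proof -
        have "mean m l \<theta> (block l s \<omega>) = (\<Sum>i=1..l. m \<theta> (Z (s + i) \<omega>)) / ereal (real l)"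
          by (simp add: mean_def sample_def)
        then have "(\<Sum>i=1..l. m \<theta> (Z (s + i) \<omega>)) / ereal (real l) \<le> ereal c"
          using c mbar_eq[OF l \<theta>(2) block_in_space[OF w_space(1)]] by simp
        moreover have "l > 0" using l k by auto
        ultimately show ?thesis
          by (simp add: ereal_divide_le_pos)
      qed
      have "(\<Sum>i=1..n. m \<theta> (Z i \<omega>)) = (\<Sum>j<q n. \<Sum>i=1..k. m \<theta> (Z (j * k + i) \<omega>)) +
          (\<Sum>i=1..len n. m \<theta> (Z (q n * k + i) \<omega>))"
        by (subst n_eq[OF n(2)]) (rule sum_blocks)
      also have "\<dots> \<le> (\<Sum>j<q n. ereal (real k * G (block k (j * k) \<omega>))) + ereal L"
      proof (intro add_mono sum_mono)
        show "(\<Sum>i=1..k. m \<theta> (Z (j * k + i) \<omega>)) \<le> ereal (real k * G (block k (j * k) \<omega>))" for j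
          using good[OF w_space(2)] \<theta>(1) k by (intro block_sum) auto
        show "(\<Sum>i=1..len n. m \<theta> (Z (q n * k + i) \<omega>)) \<le> ereal L"
          unfolding L_def using good[OF w_space(2)] \<theta>(1) len[of n] by (intro block_sum) blast+
      qed
      also have "\<dots> = ereal (real k * SG + L)"
        by (simp add: SG_def sum_distrib_left)
      finally have "mean m n \<theta> (\<lambda>i. Z i \<omega>) \<le> ereal (real k * SG + L) / ereal (real n)"
        unfolding mean_def using n by (intro ereal_divide_right_mono) auto
      then have upper: "mean m n \<theta> (\<lambda>i. Z i \<omega>) \<le> ereal ((real k * SG + L) / real n)"
        using n by simp
      have "(\<Sum>i=1..n. m \<theta>\<^sub>0 (Z i \<omega>)) = (\<Sum>i=1..n. ereal (X (Z i \<omega>)))"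
        using good[OF w_space(2)] by (intro sum.cong) (auto simp: X_def ereal_real)
      then have lower: "mean m n \<theta>\<^sub>0 (\<lambda>i. Z i \<omega>) = ereal (SX / real n)"
        using n by (simp add: mean_def SX_def)
      obtain r where r: "\<rho> n \<omega> = ereal r" "r \<le> \<eta>"
        using ev2 \<rho>[OF n(1) w_space(1)] by (cases "\<rho> n \<omega>") auto
      have "ereal (SX / real n - r) \<le> mean m n \<theta> (\<lambda>i. Z i \<omega>)"
        using \<rho>[OF n(1) w_space(1)] by (simp add: lower r \<theta>_def)
      then have "SX / real n - r \<le> (real k * SG + L) / real n"
        using upper by (metis order_trans ereal_less_eq(3))
      then have "v - 2 * \<eta> < (real k * SG) / real n + L / real n"
        using ev1 r by (simp add: add_divide_distrib)
      moreover have "L / real n < \<eta>" using ev4 n by (simp add: field_simps)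
      moreover have "(real k * SG) / real n \<le> a + 2 * \<eta>"
      proof -
        \<comment> \<open>\<open>x\<close> is the weight of the complete blocks. Since
          \<open>a + \<eta>\<close> may be negative, \<open>x\<close> is compared with 1 in absolute
          value.\<close>
        define x where "x = real k * real (q n) / real n"
        have "real n = real k * real (q n) + real (len n)"
          by (subst n_eq[OF n(2)]) (simp add: mult.commute)
        then have "x = (real n - real (len n)) / real n" by (simp add: x_def)
        then have "\<bar>x - 1\<bar> = real (len n) / real n"
          using n by (simp add: diff_divide_distrib)
        also have "\<dots> \<le> 2 * real k / real n"
          using len[of n] by (intro divide_right_mono) auto
        finally have x: "x \<ge> 0" "\<bar>x - 1\<bar> \<le> 2 * real k * inverse (real n)"
          by (auto simp: x_def divide_inverse)
        have "(real k * SG) / real n = x * (SG / real (q n))"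
          using q by (simp add: x_def)
        also have "\<dots> \<le> x * (a + \<eta>)"
          using x(1) ev3 by (intro mult_left_mono) auto
        also have "\<dots> = (a + \<eta>) + (x - 1) * (a + \<eta>)" by (simp add: algebra_simps)
        also have "(x - 1) * (a + \<eta>) \<le> \<bar>x - 1\<bar> * \<bar>a + \<eta>\<bar>"
          by (metis abs_ge_self abs_mult)
        also have "\<dots> \<le> (2 * real k * inverse (real n)) * \<bar>a + \<eta>\<bar>"
          using x(2) by (intro mult_right_mono) auto
        also have "\<dots> < \<eta>" using elim(1) by (simp add: mult_ac)
        finally show ?thesis by simp
      qed
      ultimately have "v - a < 5 * \<eta>" by linarith
      then show False using \<eta> by (simp add: \<eta>_def)
    qed
  qed
  then show ?thesis using E_sets E_lim by blast
qed

end

section \<open>Integrable bounds for block means at a single parameter\<close>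

context iid_sequence
begin

lemma expect_Z: "f \<in> borel_measurable A \<Longrightarrow> expect M (\<lambda>\<omega>. f (Z i \<omega>)) = expect (distr M A (Z 0)) f"
  unfolding distr_Z[of i, symmetric] by (simp add: expect_distr)

lemma AE_Z:
  assumes "AE z in distr M A (Z 0). Q z"
  shows "AE \<omega> in M. Q (Z i \<omega>)"
proof (rule AE_distrD[OF Z_measurable])
  show "AE z in distr M A (Z i). Q z" by (subst distr_Z) (rule assms)
qed

text \<open>The real bound is found for one observation and then averaged over the block, which
  preserves its expectation. In this way only additivity of real integrals is used, not of
  \<open>expect\<close>.\<close>

lemma mean_integrable_bound:
  fixes m :: "'t \<Rightarrow> 'z \<Rightarrow> ereal"
  assumes m_meas: "m \<theta> \<in> borel_measurable A" and k: "k \<ge> 1"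
    and less: "expect M (\<lambda>\<omega>. m \<theta> (Z 0 \<omega>)) < ereal v"
  shows "\<exists>g. integrable (distr M (power_space A k) (sample Z k)) g \<and>
           (AE z in distr M (power_space A k) (sample Z k). mean m k \<theta> z \<le> ereal (g z)) \<and>
           integral\<^sup>L (distr M (power_space A k) (sample Z k)) g < v"
proof -
  let ?Q = "distr M (power_space A k) (sample Z k)"
  interpret L: prob_space "distr M A (Z 0)" by (rule prob_space_distr) simp
  have "\<exists>g0. integrable (distr M A (Z 0)) g0 \<and> (AE z in distr M A (Z 0). m \<theta> z \<le> ereal (g0 z)) \<and>
      integral\<^sup>L (distr M A (Z 0)) g0 < v"
    using m_meas less by (intro expect_less_imp_integrable_bound) (auto simp: expect_Z intro: L.finite_measure_axioms)
  then obtain g0 where g0: "integrable (distr M A (Z 0)) g0" "AE z in distr M A (Z 0). m \<theta> z \<le> ereal (g0 z)"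
    "integral\<^sup>L (distr M A (Z 0)) g0 < v"
    by blast
  have g0_meas[measurable]: "g0 \<in> borel_measurable A" using g0(1) by auto
  have int: "integrable M (\<lambda>\<omega>. g0 (Z i \<omega>))" "expectation (\<lambda>\<omega>. g0 (Z i \<omega>)) = integral\<^sup>L (distr M A (Z 0)) g0" for i
    using g0(1) unfolding distr_Z[of i, symmetric] by (auto simp: integrable_distr_eq integral_distr)
  define g where "g z = (\<Sum>i=1..k. g0 (z i)) / real k" for z :: "nat \<Rightarrow> 'z"
  have g_meas: "g \<in> borel_measurable (power_space A k)"
    unfolding g_def by measurable
  have g_sample: "g (sample Z k \<omega>) = (\<Sum>i=1..k. g0 (Z i \<omega>)) / real k" for \<omega>
    by (simp add: g_def sample_def)
  have "integrable ?Q g"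
    by (subst integrable_distr_eq[OF sample_measurable g_meas]) (auto simp: g_sample int(1))
  moreover have "integral\<^sup>L ?Q g = integral\<^sup>L (distr M A (Z 0)) g0"
    using k by (subst integral_distr[OF sample_measurable g_meas]) (auto simp: g_sample int)
  moreover have "AE z in ?Q. mean m k \<theta> z \<le> ereal (g z)"
  proof -
    have meas: "{z \<in> space (power_space A k). \<forall>i\<in>{1..k}. m \<theta> (z i) \<le> ereal (g0 (z i))} \<in> sets (power_space A k)"
      using m_meas by measurable
    have "AE \<omega> in M. \<forall>i\<in>{1..k}. m \<theta> (Z i \<omega>) \<le> ereal (g0 (Z i \<omega>))"
      using AE_Z[OF g0(2)] by (intro AE_finite_allI) auto
    then have "AE z in ?Q. \<forall>i\<in>{1..k}. m \<theta> (z i) \<le> ereal (g0 (z i))"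
      by (subst AE_distr_iff[OF sample_measurable meas]) (simp add: sample_def)
    then show ?thesis
    proof eventually_elim
      case (elim z)
      have "(\<Sum>i=1..k. m \<theta> (z i)) \<le> (\<Sum>i=1..k. ereal (g0 (z i)))"
        using elim by (intro sum_mono) auto
      then have "mean m k \<theta> z \<le> (\<Sum>i=1..k. ereal (g0 (z i))) / ereal (real k)"
        unfolding mean_def using k by (intro ereal_divide_right_mono) auto
      also have "\<dots> = ereal (g z)" using k by (simp add: g_def)
      finally show ?case .
    qed
  qed
  ultimately show ?thesis using g0(3) by auto
qed

end

theorem theorem3p1:
  fixes M :: "'w measure" and A :: "'z measure" and Z :: "nat \<Rightarrow> 'w \<Rightarrow> 'z"
    and T :: "'t::metric_space set"
    and m :: "'t \<Rightarrow> 'z \<Rightarrow> ereal"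
    and mbar :: "nat \<Rightarrow> 't \<Rightarrow> (nat \<Rightarrow> 'z) \<Rightarrow> ereal"
    and k :: nat
    and \<theta>hat :: "nat \<Rightarrow> 'w \<Rightarrow> 't"
    and \<theta>\<^sub>0 :: 't
    and \<epsilon> :: real and K :: "'t set"
  assumes "prob_space M"
    and "iid M A Z"
    and "T \<noteq> {}"
    and "\<And>\<theta> z. \<theta> \<in> T \<Longrightarrow> z \<in> space A \<Longrightarrow> m \<theta> z \<noteq> \<infinity>"
    and "\<And>\<theta>. \<theta> \<in> T \<Longrightarrow> m \<theta> \<in> borel_measurable A"
    and "k \<ge> 1"
    and "\<And>l \<theta> z. l \<in> {k..2*k-1} \<Longrightarrow> z \<in> space (power_space A l) \<Longrightarrow> mbar l \<theta> z \<noteq> \<infinity>"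
    and "\<And>l \<theta>. l \<in> {k..2*k-1} \<Longrightarrow> mbar l \<theta> \<in> borel_measurable (power_space A l)"
    and "\<And>l \<theta> z. l \<in> {k..2*k-1} \<Longrightarrow> \<theta> \<in> T \<Longrightarrow> z \<in> space (power_space A l) \<Longrightarrow>
           mbar l \<theta> z = mean m l \<theta> z"
    and "\<And>l. l \<in> {k..2*k-1} \<Longrightarrow> as_usc (distr M (power_space A l) (sample Z l)) (mbar l)"
    and "\<And>l. l \<in> {k..2*k-1} \<Longrightarrow> wald_integrable (distr M (power_space A l) (sample Z l)) (mbar l)"
    and "\<And>\<theta>. \<theta> \<notin> T \<Longrightarrow> expect M (\<lambda>\<omega>. mbar k \<theta> (sample Z k \<omega>)) = -\<infinity>"
    and "maximizers M T m (Z 0) \<noteq> {}"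
    and "\<And>n \<omega>. n \<ge> 1 \<Longrightarrow> \<omega> \<in> space M \<Longrightarrow> \<theta>hat n \<omega> \<in> T"
    and "\<theta>\<^sub>0 \<in> maximizers M T m (Z 0)"
    and "near_maximizer M (\<lambda>n \<theta> \<omega>. mean m n \<theta> (\<lambda>i. Z i \<omega>)) \<theta>hat \<theta>\<^sub>0"
    and "\<epsilon> > 0"
    and "compact K"
  shows "(\<lambda>n. outer_measure_of M
            {\<omega> \<in> space M. infdist (\<theta>hat n \<omega>) (maximizers M T m (Z 0)) \<ge> \<epsilon> \<and> \<theta>hat n \<omega> \<in> K})
         \<longlonglongrightarrow> 0"
proof -
  interpret prob_space M by fact
  interpret iid_sequence M A Z by unfold_locales fact
  note m_meas = assms(5) and k = \<open>k \<ge> 1\<close> and mbar_eq = assms(9) and hat = assms(14)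
  define \<Theta>\<^sub>0 where "\<Theta>\<^sub>0 = maximizers M T m (Z 0)"
  define Q where "Q l = distr M (power_space A l) (sample Z l)" for l
  have k_mem: "k \<in> {k..2*k-1}" using k by auto
  have \<theta>\<^sub>0: "\<theta>\<^sub>0 \<in> T" "\<theta>\<^sub>0 \<in> \<Theta>\<^sub>0"
    using assms(15) by (auto simp: \<Theta>\<^sub>0_def maximizers_def)
  define e where "e \<theta> = expect M (\<lambda>\<omega>. m \<theta> (Z 0 \<omega>))" for \<theta>
  have e_le: "e \<theta> \<le> e \<theta>\<^sub>0" if "\<theta> \<in> T" for \<theta>
    using assms(15) that by (auto simp: maximizers_def e_def intro: SUP_upper2)
  have \<Theta>\<^sub>0_iff: "\<theta> \<in> \<Theta>\<^sub>0 \<longleftrightarrow> \<theta> \<in> T \<and> e \<theta> = e \<theta>\<^sub>0" for \<theta>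
    using assms(15) by (auto simp: \<Theta>\<^sub>0_def maximizers_def e_def)
  let ?bad = "\<lambda>n. {\<omega> \<in> space M. infdist (\<theta>hat n \<omega>) \<Theta>\<^sub>0 \<ge> \<epsilon> \<and> \<theta>hat n \<omega> \<in> K}"
  have mm[measurable]: "m \<theta>\<^sub>0 \<in> borel_measurable A" using m_meas \<theta>\<^sub>0 by blast

  have wald: "wald_integrable_at (Q l) (mbar l) \<theta>" if "l \<in> {k..2*k-1}" for l \<theta>
    using assms(11)[OF that] by (simp add: wald_integrable_def Q_def)
  have usc: "as_usc_at (Q l) (mbar l) \<theta>" if "l \<in> {k..2*k-1}" for l \<theta>
    using assms(10)[OF that] by (simp add: as_usc_def Q_def)

  \<comment> \<open>Wald's condition at \<open>\<theta>\<^sub>0\<close> bounds the mean of a whole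
    block; independence turns this into a statement about one observation.\<close>
  have pos: "(\<integral>\<^sup>+ \<omega>. e2ennreal (m \<theta>\<^sub>0 (Z 0 \<omega>)) \<partial>M) < \<infinity>"
  proof -
    obtain r H where "r > 0" and H: "integrable (Q k) H" "AE z in Q k. \<forall>\<theta>'\<in>ball \<theta>\<^sub>0 r. mbar k \<theta>' z \<le> ereal (H z)"
      using wald_integrable_bound[OF wald[OF k_mem]] by blast
    have "integrable M (\<lambda>\<omega>. real k * H (sample Z k \<omega>))"
      using H(1) by (intro integrable_mult_right integrable_distr[OF sample_measurable]) (simp add: Q_def)
    moreover have "AE \<omega> in M. \<forall>\<theta>'\<in>ball \<theta>\<^sub>0 r. mbar k \<theta>' (sample Z k \<omega>) \<le> ereal (H (sample Z k \<omega>))"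
      using H(2) unfolding Q_def by (rule AE_distrD[OF sample_measurable])
    then have "AE \<omega> in M. (\<Sum>i=1..k. m \<theta>\<^sub>0 (Z i \<omega>)) \<le> ereal (real k * H (sample Z k \<omega>))"
      using AE_space
    proof eventually_elim
      case (elim \<omega>)
      have "sample Z k \<omega> \<in> space (power_space A k)"
        using measurable_space[OF sample_measurable elim(2)] .
      then have "mean m k \<theta>\<^sub>0 (sample Z k \<omega>) \<le> ereal (H (sample Z k \<omega>))"
        using bspec[OF elim(1), of \<theta>\<^sub>0] \<open>r > 0\<close> by (simp add: mbar_eq[OF k_mem \<theta>\<^sub>0(1)])
      then show ?case
        using k by (simp add: mean_def sample_def ereal_divide_le_pos)
    qed
    ultimately show ?thesis by (intro nn_integral_pos_part_finite[OF mm k])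
  qed

  show ?thesis
  proof (cases "(\<integral>\<^sup>+ \<omega>. e2ennreal (- m \<theta>\<^sub>0 (Z 0 \<omega>)) \<partial>M) < \<infinity>")
    \<comment> \<open>The maximal value is -\<infinity>, so all of \<open>T\<close> maximizes. The
      estimators then have distance 0 from the maximizers, and the bad event is empty for
      \<open>n \<ge> 1\<close>.\<close>
    case False
    then have "e \<theta>\<^sub>0 = -\<infinity>"
      using pos unfolding e_def expect_def e2ennreal_max_0
      by (cases "\<integral>\<^sup>+ \<omega>. e2ennreal (m \<theta>\<^sub>0 (Z 0 \<omega>)) \<partial>M") (auto simp: less_top[symmetric] enn2ereal_ennreal)
    then have "T \<subseteq> \<Theta>\<^sub>0" using e_le by (auto simp: \<Theta>\<^sub>0_iff)
    then have empty: "?bad n = {}" if "n \<ge> 1" for n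
      using hat[OF that] \<open>\<epsilon> > 0\<close> by fastforce
    have "\<forall>\<^sub>F n in sequentially. outer_measure_of M (?bad n) = 0"
      by (intro eventually_sequentiallyI[of 1])
         (simp only: empty outer_measure_of_eq sets.empty_sets emeasure_empty)
    then show ?thesis unfolding \<Theta>\<^sub>0_def by (rule tendsto_eventually)
  next
    case True
    note X = expect_eq_integral[OF _ pos True]
    define v where "v = expectation (\<lambda>\<omega>. real_of_ereal (m \<theta>\<^sub>0 (Z 0 \<omega>)))"
    have e_v: "e \<theta>\<^sub>0 = ereal v" unfolding e_def v_def by (rule X(3)) simp
    have fin: "AE \<omega> in M. \<forall>i. \<bar>m \<theta>\<^sub>0 (Z i \<omega>)\<bar> \<noteq> \<infinity>"
    proof -
      have "AE \<omega> in M. \<bar>m \<theta>\<^sub>0 (Z 0 \<omega>)\<bar> \<noteq> \<infinity>" by (rule X(2)) simp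
      then have "AE z in distr M A (Z 0). \<bar>m \<theta>\<^sub>0 z\<bar> \<noteq> \<infinity>"
        by (subst AE_distr_iff) auto
      then show ?thesis unfolding AE_all_countable by (intro allI AE_Z)
    qed
    \<comment> \<open>A point of \<open>T\<close> that is not a maximizer has an expectation
      strictly below \<open>v\<close>; a point outside \<open>T\<close> has block expectation
      -\<infinity>.\<close>
    have bound: "\<exists>g. integrable (Q k) g \<and> (AE z in Q k. mbar k \<theta> z \<le> ereal (g z)) \<and> integral\<^sup>L (Q k) g < v"
      if "\<theta> \<notin> \<Theta>\<^sub>0" for \<theta>
    proof (cases "\<theta> \<in> T")
      case True
      then have "e \<theta> < ereal v" using that e_le[of \<theta>] e_v by (auto simp: \<Theta>\<^sub>0_iff)
      then obtain g where g: "integrable (Q k) g" "AE z in Q k. mean m k \<theta> z \<le> ereal (g z)" "integral\<^sup>L (Q k) g < v"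
        using mean_integrable_bound[of m \<theta> k v] m_meas[OF True] k unfolding e_def Q_def by blast
      have "AE z in Q k. mbar k \<theta> z \<le> ereal (g z)"
        using g(2) AE_space[of "Q k"]
        by eventually_elim (simp add: Q_def mbar_eq[OF k_mem True])
      then show ?thesis using g by blast
    next
      case False
      interpret Qk: prob_space "Q k" unfolding Q_def by (rule prob_space_distr[OF sample_measurable])
      have "expect (Q k) (mbar k \<theta>) = -\<infinity>"
        unfolding Q_def expect_distr[OF sample_measurable assms(8)[OF k_mem]] by (rule assms(12)[OF False])
      then show ?thesis
        by (intro expect_less_imp_integrable_bound Qk.finite_measure_axioms)
           (use assms(8)[OF k_mem, of \<theta>] in \<open>simp_all add: Q_def\<close>)
    qed
    have escape: "\<exists>r E. r > 0 \<and> (\<forall>n. E n \<in> sets M) \<and>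
        (\<forall>\<^sub>F n in sequentially. {\<omega> \<in> space M. \<theta>hat n \<omega> \<in> ball \<theta> r} \<subseteq> E n) \<and> (\<lambda>n. prob (E n)) \<longlonglongrightarrow> 0"
      if off: "\<theta> \<notin> \<Theta>\<^sub>0" for \<theta>
    proof -
      obtain g where g: "integrable (Q k) g" "AE z in Q k. mbar k \<theta> z \<le> ereal (g z)" "integral\<^sup>L (Q k) g < v"
        using bound[OF off] by blast
      obtain r0 G where "r0 > 0" and G: "integrable (Q k) G" "integral\<^sup>L (Q k) G < v"
          "AE z in Q k. \<forall>\<theta>'\<in>ball \<theta> r0. mbar k \<theta>' z \<le> ereal (G z)"
        using as_usc_wald_integrable_bound[OF usc[OF k_mem] wald[OF k_mem] g] by blast
      have "\<exists>r H. 0 < r \<and> integrable (Q l) H \<and> (\<forall>z. 0 \<le> H z) \<and>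
          (AE z in Q l. \<forall>\<theta>'\<in>ball \<theta> r. mbar l \<theta>' z \<le> ereal (H z))" if "l \<in> {k..2*k-1}" for l
        using wald_integrable_bound[OF wald[OF that, of \<theta>]] by blast
      then have "\<forall>l\<in>{k..2*k-1}. \<exists>r H. 0 < r \<and> integrable (Q l) H \<and> (\<forall>z. 0 \<le> H z) \<and>
          (AE z in Q l. \<forall>\<theta>'\<in>ball \<theta> r. mbar l \<theta>' z \<le> ereal (H z))"
        by (rule ballI)
      then obtain rl H where rH: "\<forall>l\<in>{k..2*k-1}. 0 < rl l \<and> integrable (Q l) (H l) \<and> (\<forall>z. 0 \<le> H l z) \<and>
          (AE z in Q l. \<forall>\<theta>'\<in>ball \<theta> (rl l). mbar l \<theta>' z \<le> ereal (H l z))"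
        unfolding bchoice_iff by blast
      \<comment> \<open>The radii from Wald's condition depend on the block length; finitely many
        lengths allow one common radius.\<close>
      define r where "r = Min (insert r0 (rl ` {k..2*k-1}))"
      have r: "r > 0" "r \<le> r0"
        using \<open>r0 > 0\<close> rH by (auto simp: r_def)
      have r_le: "r \<le> rl l" if "l \<in> {k..2*k-1}" for l
        unfolding r_def using that by (intro Min_le) auto
      have "\<exists>E. (\<forall>n. E n \<in> sets M) \<and> (\<forall>\<^sub>F n in sequentially. {\<omega> \<in> space M. \<theta>hat n \<omega> \<in> ball \<theta> r} \<subseteq> E n) \<and>
           (\<lambda>n. prob (E n)) \<longlonglongrightarrow> 0"
      proof (rule estimator_escapes_set[OF k mbar_eq mm fin, where G = G and H = H, folded Q_def])
        show "AE z in Q k. \<forall>\<theta>'\<in>ball \<theta> r. mbar k \<theta>' z \<le> ereal (G z)"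
          using G(3) by eventually_elim (use r(2) in auto)
        show "AE z in Q l. \<forall>\<theta>'\<in>ball \<theta> r. mbar l \<theta>' z \<le> ereal (H l z)" if "l \<in> {k..2*k-1}" for l
        proof -
          have "AE z in Q l. \<forall>\<theta>'\<in>ball \<theta> (rl l). mbar l \<theta>' z \<le> ereal (H l z)"
            using bspec[OF rH that] by blast
          then show ?thesis by eventually_elim (use r_le[OF that] in auto)
        qed
        show "integrable M (\<lambda>\<omega>. real_of_ereal (m \<theta>\<^sub>0 (Z 0 \<omega>)))" by (rule X(1)) simp
      qed (use G rH hat assms(16) in \<open>auto simp: v_def\<close>)
      then show ?thesis using r(1) by blast
    qed
    \<comment> \<open>This set may contain points outside \<open>T\<close>, since limits of
      estimators need not stay in \<open>T\<close>. It avoids the maximizers because the distance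
      vanishes there.\<close>
    define C where "C = K \<inter> {\<theta>. infdist \<theta> \<Theta>\<^sub>0 \<ge> \<epsilon>}"
    have "closed {\<theta>. infdist \<theta> \<Theta>\<^sub>0 \<ge> \<epsilon>}"
      by (intro closed_Collect_le continuous_intros)
    then have "compact C" unfolding C_def using \<open>compact K\<close> by (rule compact_Int_closed[rotated])
    have "\<theta> \<notin> \<Theta>\<^sub>0" if "\<theta> \<in> C" for \<theta>
      using that \<open>\<epsilon> > 0\<close> by (auto simp: C_def)
    then have "\<forall>\<theta>\<in>C. \<exists>r E. r > 0 \<and> (\<forall>n. E n \<in> sets M) \<and>
        (\<forall>\<^sub>F n in sequentially. {\<omega> \<in> space M. \<theta>hat n \<omega> \<in> ball \<theta> r} \<subseteq> E n) \<and> (\<lambda>n. prob (E n)) \<longlonglongrightarrow> 0"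
      by (intro ballI escape)
    then obtain r E where rE: "\<forall>\<theta>\<in>C. r \<theta> > 0 \<and> (\<forall>n. E \<theta> n \<in> sets M) \<and>
        (\<forall>\<^sub>F n in sequentially. {\<omega> \<in> space M. \<theta>hat n \<omega> \<in> ball \<theta> (r \<theta>)} \<subseteq> E \<theta> n) \<and>
        (\<lambda>n. prob (E \<theta> n)) \<longlonglongrightarrow> 0"
      unfolding bchoice_iff by blast
    obtain D where D: "D \<subseteq> C" "finite D" "C \<subseteq> (\<Union>\<theta>\<in>D. ball \<theta> (r \<theta>))"
      by (rule compactE_image[OF \<open>compact C\<close>, of C "\<lambda>\<theta>. ball \<theta> (r \<theta>)"])
         (use rE in force)+
    have "\<forall>\<^sub>F n in sequentially. \<forall>\<theta>\<in>D. {\<omega> \<in> space M. \<theta>hat n \<omega> \<in> ball \<theta> (r \<theta>)} \<subseteq> E \<theta> n"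
      using D rE by (intro eventually_ball_finite) auto
    then have upper: "\<forall>\<^sub>F n in sequentially. outer_measure_of M (?bad n) \<le> ennreal (\<Sum>\<theta>\<in>D. prob (E \<theta> n))"
    proof eventually_elim
      case (elim n)
      have sets: "E \<theta> n \<in> sets M" if "\<theta> \<in> D" for \<theta>
        using that D rE by blast
      have "?bad n \<subseteq> (\<Union>\<theta>\<in>D. E \<theta> n)"
      proof
        fix \<omega> assume "\<omega> \<in> ?bad n"
        then have w: "\<omega> \<in> space M" "\<theta>hat n \<omega> \<in> C" by (auto simp: C_def)
        then obtain \<theta> where "\<theta> \<in> D" "\<theta>hat n \<omega> \<in> ball \<theta> (r \<theta>)" using D(3) by blast
        then show "\<omega> \<in> (\<Union>\<theta>\<in>D. E \<theta> n)" using elim w(1) by blast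
      qed
      \<comment> \<open>The bad event need not be measurable, but the finite union that covers it
        is.\<close>
      then have "outer_measure_of M (?bad n) \<le> outer_measure_of M (\<Union>\<theta>\<in>D. E \<theta> n)"
        by (rule outer_measure_of_mono)
      also have "\<dots> = emeasure M (\<Union>\<theta>\<in>D. E \<theta> n)"
        using sets D(2) by (intro outer_measure_of_eq) auto
      also have "\<dots> \<le> ennreal (\<Sum>\<theta>\<in>D. prob (E \<theta> n))"
        unfolding emeasure_eq_measure using sets D(2) by (intro ennreal_leI measure_UNION_le) auto
      finally show ?case .
    qed
    have "(\<lambda>n. \<Sum>\<theta>\<in>D. prob (E \<theta> n)) \<longlonglongrightarrow> (\<Sum>\<theta>\<in>D. 0)"
      using D rE by (intro tendsto_sum) auto
    then have lim: "(\<lambda>n. ennreal (\<Sum>\<theta>\<in>D. prob (E \<theta> n))) \<longlonglongrightarrow> 0"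
      using tendsto_ennrealI by fastforce
    show ?thesis
      unfolding \<Theta>\<^sub>0_def[symmetric]
      by (rule tendsto_sandwich[OF _ upper tendsto_const lim]) simp
  qed
qed

end
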